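(* (i) For every basic sequence $Q$ and every non-zero integer $r$: if $x$ is $Q$-distribution normal then $rx$ is $Q$-distribution normal. (ii) If $Q$ is infinite in limit and $r\in\mathbb{Q}\setminus\mathbb{Z}$, then the set $S_r=\{x\in\mathscr{DN}(Q): rx\notin\mathscr{DN}(Q)\}$ satisfies $\lambda(S_r)=0$ and $\dim_H(S_r)=1$, where $\lambda$ is Lebesgue measure and $\dim_H$ is Hausdorff dimension.
   Context: A basic sequence is a sequence $Q=(q_n)_{n\ge1}$ of integers with $q_n\ge2$; it is infinite in limit if $q_n\to\infty$. Let $T_{Q,n}(x)=\left(\prod_{j=1}^n q_j\right)x \bmod 1$. A real $x$ is $Q$-distribution normal if $(T_{Q,n}(x))_{n\ge0}$ is uniformly distributed modulo $1$; $\mathscr{DN}(Q)$ denotes the set of $Q$-distribution normal numbers. *)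

theory Defs
  imports "HOL-Analysis.Analysis"
begin

text \<open>A basic sequence Q = (q_n)_{n>=1}: integers q_n >= 2. Represented as q :: nat => nat;
  the value q 0 is irrelevant.\<close>
definition basic_seq :: "(nat \<Rightarrow> nat) \<Rightarrow> bool" where
  "basic_seq q \<longleftrightarrow> (\<forall>n\<ge>1. q n \<ge> 2)"

definition infinite_in_limit :: "(nat \<Rightarrow> nat) \<Rightarrow> bool" where
  "infinite_in_limit q \<longleftrightarrow> filterlim q at_top sequentially"

definition T_Q :: "(nat \<Rightarrow> nat) \<Rightarrow> nat \<Rightarrow> real \<Rightarrow> real" where
  "T_Q q n x = frac ((\<Prod>j=1..n. real (q j)) * x)"

definition uniformly_distributed_mod1 :: "(nat \<Rightarrow> real) \<Rightarrow> bool" where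
  "uniformly_distributed_mod1 s \<longleftrightarrow>
     (\<forall>a b. 0 \<le> a \<longrightarrow> a \<le> b \<longrightarrow> b \<le> 1 \<longrightarrow>
        (\<lambda>N. real (card {n\<in>{..<N}. frac (s n) \<in> {a..<b}}) / real N) \<longlonglongrightarrow> b - a)"

definition DN :: "(nat \<Rightarrow> nat) \<Rightarrow> real set" where
  "DN q = {x. uniformly_distributed_mod1 (\<lambda>n. T_Q q n x)}"

definition hausdorff_content :: "real \<Rightarrow> real \<Rightarrow> real set \<Rightarrow> ennreal" where
  "hausdorff_content s \<delta> A =
     (INF U \<in> {U :: nat \<Rightarrow> real set. A \<subseteq> (\<Union>i. U i) \<and>
                 (\<forall>i. bounded (U i) \<and> diameter (U i) \<le> \<delta>)}.
        \<Sum>i. ennreal (diameter (U i) powr s))"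

definition hausdorff_outer_measure :: "real \<Rightarrow> real set \<Rightarrow> ennreal" where
  "hausdorff_outer_measure s A = (SUP \<delta>\<in>{0<..}. hausdorff_content s \<delta> A)"

definition hausdorff_dim :: "real set \<Rightarrow> real" where
  "hausdorff_dim A = Inf {s. 0 < s \<and> hausdorff_outer_measure s A = 0}"

end

theory Submission
  imports Defs
begin

text \<open>Multiplication by an integer \<open>r > 0\<close> preserves uniform distribution because the preimage of an
  interval under \<open>t \<mapsto> r t mod 1\<close> consists of \<open>r\<close> intervals of \<open>1/r\<close> times its length; for
  non-integral \<open>r > 0\<close> the same map on \<open>[0, 1)\<close> has \<open>\<lceil>r\<rceil>\<close> preimage intervals over an initial segment,
  so it destroys uniform distribution.

  Almost every \<open>x\<close> is normal by a second moment estimate: the correlation of the events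
  \<open>T\<^sub>m x \<in> [a, b)\<close> and \<open>T\<^sub>n x \<in> [a, b)\<close> is at most \<open>2 / (q\<^sub>m\<^sub>+\<^sub>1 \<cdots> q\<^sub>n)\<close>. Hence the exceptional set is
  null.

  For the dimension fix \<open>s < 1\<close>, a denominator \<open>b\<close> of \<open>r\<close> and one normal number \<open>x\<^sub>0\<close>, and consider the
  Cantor set of all \<open>x\<close> whose \<open>n\<close>-th digit is divisible by \<open>b\<close> and, after division by \<open>q\<^sub>n\<close>, within
  \<open>O(1/k\<^sub>n)\<close> of \<open>T\<^sub>n\<^sub>-\<^sub>1 x\<^sub>0\<close>, where \<open>k\<^sub>n\<close> tends to infinity slowly. Each such \<open>x\<close> is normal since its orbit
  is asymptotic to that of \<open>x\<^sub>0\<close>; and \<open>r x\<close> is not, since the integer part of \<open>q\<^sub>1 \<cdots> q\<^sub>n x\<close> is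
  divisible by \<open>b\<close> and thus \<open>T\<^sub>n (r x) = r T\<^sub>n x mod 1\<close>. Reading the digits in a different base maps
  the Cantor set onto \<open>[0, 1)\<close> by an \<open>s\<close>-Hoelder map, so its \<open>s\<close>-dimensional measure is
  positive.\<close>

section \<open>Frequencies and uniform distribution\<close>

definition freq :: "(nat \<Rightarrow> real) \<Rightarrow> real set \<Rightarrow> nat \<Rightarrow> real" where
  "freq s J N = real (card {n\<in>{..<N}. frac (s n) \<in> J}) / real N"

lemma uniformly_distributed_mod1_freq:
  "uniformly_distributed_mod1 s \<longleftrightarrow>
     (\<forall>a b. 0 \<le> a \<longrightarrow> a \<le> b \<longrightarrow> b \<le> 1 \<longrightarrow> freq s {a..<b} \<longlonglongrightarrow> b - a)"
  unfolding uniformly_distributed_mod1_def freq_def ..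

lemma uniformly_distributed_mod1D:
  assumes "uniformly_distributed_mod1 s" "0 \<le> a" "a \<le> b" "b \<le> 1" "c = b - a"
  shows "freq s {a..<b} \<longlonglongrightarrow> c"
  using assms by (simp add: uniformly_distributed_mod1_freq)

lemma freq_cong:
  assumes "\<And>n. frac (s n) \<in> J \<longleftrightarrow> frac (t n) \<in> K"
  shows "freq s J N = freq t K N"
  using assms by (simp add: freq_def)

text \<open>The first \<open>n0\<close> indices, where the implication may fail, cost at most
  \<open>n0 / N\<close>. With \<open>n0 = 0\<close> this is monotonicity of the frequency.\<close>

lemma freq_le_freq_plus:
  assumes "\<And>n. n \<ge> n0 \<Longrightarrow> frac (s n) \<in> J \<Longrightarrow> frac (t n) \<in> K"
  shows "freq s J N \<le> freq t K N + real n0 / real N"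
proof -
  have "card {n\<in>{..<N}. frac (s n) \<in> J} \<le> card ({n\<in>{..<N}. frac (t n) \<in> K} \<union> {..<n0})"
    using assms by (intro card_mono) (auto simp: not_le)
  also have "\<dots> \<le> card {n\<in>{..<N}. frac (t n) \<in> K} + n0"
    using card_Un_le[of "{n\<in>{..<N}. frac (t n) \<in> K}" "{..<n0}"] by simp
  finally show ?thesis
    unfolding freq_def add_divide_distrib[symmetric]
    by (intro divide_right_mono) (simp_all flip: of_nat_add)
qed

lemma freq_UNION:
  assumes "finite I" "disjoint_family_on A I"
  shows "freq s (\<Union>i\<in>I. A i) N = (\<Sum>i\<in>I. freq s (A i) N)"
proof -
  have "{n\<in>{..<N}. frac (s n) \<in> (\<Union>i\<in>I. A i)} = (\<Union>i\<in>I. {n\<in>{..<N}. frac (s n) \<in> A i})"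
    by auto
  moreover have "card (\<Union>i\<in>I. {n\<in>{..<N}. frac (s n) \<in> A i}) =
      (\<Sum>i\<in>I. card {n\<in>{..<N}. frac (s n) \<in> A i})"
    using assms by (intro card_UN_disjoint) (auto simp: disjoint_family_on_def)
  ultimately show ?thesis
    by (simp add: freq_def sum_divide_distrib)
qed

lemma freq_partition:
  assumes "0 \<le> a" "a \<le> b" "b \<le> 1" "N > 0"
  shows "freq s {0..<a} N + freq s {a..<b} N + freq s {b..<1} N = 1"
proof -
  let ?S = "\<lambda>J. {n\<in>{..<N}. frac (s n) \<in> J}"
  have "{..<N} = ?S {0..<a} \<union> (?S {a..<b} \<union> ?S {b..<1})"
    by (auto simp: frac_ge_0 frac_lt_1)
  then have "N = card (?S {0..<a} \<union> (?S {a..<b} \<union> ?S {b..<1}))"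
    by (metis card_lessThan)
  also have "\<dots> = card (?S {0..<a}) + (card (?S {a..<b}) + card (?S {b..<1}))"
    using assms by (subst card_Un_disjoint; (subst card_Un_disjoint)?) auto
  finally have "real N = real (card (?S {0..<a})) + real (card (?S {a..<b})) + real (card (?S {b..<1}))"
    by (metis (mono_tags, lifting) of_nat_add add.assoc)
  then show ?thesis
    using assms(4) unfolding freq_def add_divide_distrib[symmetric] by simp
qed

text \<open>Lower bounds suffice because \<open>[a, b)\<close> and its complement, again a union of such
  intervals, have total frequency 1. This absorbs all endpoint effects.\<close>
lemma uniformly_distributed_mod1I:
  assumes "\<And>a b e. 0 \<le> a \<Longrightarrow> a < b \<Longrightarrow> b \<le> 1 \<Longrightarrow> 0 < e \<Longrightarrow>
             \<forall>\<^sub>F N in sequentially. b - a - e \<le> freq s {a..<b} N"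
  shows "uniformly_distributed_mod1 s"
  unfolding uniformly_distributed_mod1_freq
proof (intro allI impI)
  fix a b :: real assume ab: "0 \<le> a" "a \<le> b" "b \<le> 1"
  have *: "\<forall>\<^sub>F N in sequentially. d - c - e \<le> freq s {c..<d} N"
    if "0 \<le> c" "c \<le> d" "d \<le> 1" "0 < e" for c d e
  proof (cases "c = d")
    case True
    then show ?thesis using that by (simp add: freq_def)
  next
    case False
    with that assms[of c d e] show ?thesis by simp
  qed
  show "freq s {a..<b} \<longlonglongrightarrow> b - a"
  proof (rule tendstoI)
    fix e :: real assume e: "e > 0"
    have "\<forall>\<^sub>F N in sequentially. a - 0 - e/3 \<le> freq s {0..<a} N"
         "\<forall>\<^sub>F N in sequentially. b - a - e/3 \<le> freq s {a..<b} N"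
         "\<forall>\<^sub>F N in sequentially. 1 - b - e/3 \<le> freq s {b..<1} N"
      using ab e by (intro *; simp)+
    then show "\<forall>\<^sub>F N in sequentially. dist (freq s {a..<b} N) (b - a) < e"
      using eventually_gt_at_top[of 0]
    proof eventually_elim
      case (elim N)
      then show ?case
        using freq_partition[OF ab, of N s] e unfolding dist_real_def by linarith
    qed
  qed
qed

text \<open>Reflection turns \<open>[a, b)\<close> into an interval closed on the wrong side.
  Shrinking it by \<open>d\<close> at its lower end repairs this and also keeps
  \<open>frac (s n)\<close> away from 0, the one value where \<open>frac (- s n)\<close> differs
  from \<open>1 - frac (s n)\<close>.\<close>

lemma uniformly_distributed_mod1_uminus:
  assumes "uniformly_distributed_mod1 s"
  shows "uniformly_distributed_mod1 (\<lambda>n. - s n)"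
proof (rule uniformly_distributed_mod1I)
  fix a b e :: real assume ab: "0 \<le> a" "a < b" "b \<le> 1" "0 < e"
  define d where "d = min (e/2) (b - a)"
  have d: "0 < d" "d < e" "d \<le> b - a" using ab by (auto simp: d_def)
  have "freq s {1 - b + d..<1 - a} \<longlonglongrightarrow> (1 - a) - (1 - b + d)"
    using ab d by (intro uniformly_distributed_mod1D[OF assms]) auto
  then have "\<forall>\<^sub>F N in sequentially. b - a - e < freq s {1 - b + d..<1 - a} N"
    by (rule order_tendstoD) (use d in simp)
  then show "\<forall>\<^sub>F N in sequentially. b - a - e \<le> freq (\<lambda>n. - s n) {a..<b} N"
  proof eventually_elim
    case (elim N)
    have "freq s {1 - b + d..<1 - a} N \<le> freq (\<lambda>n. - s n) {a..<b} N + real 0 / real N"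
    proof (rule freq_le_freq_plus)
      fix n assume "frac (s n) \<in> {1 - b + d..<1 - a}"
      then have f: "1 - b + d \<le> frac (s n)" "frac (s n) < 1 - a" by auto
      with d ab have "frac (s n) \<noteq> 0" by linarith
      then have "s n \<notin> \<int>" by simp
      then have "frac (- s n) = 1 - frac (s n)" by (simp add: frac_neg)
      then show "frac (- s n) \<in> {a..<b}" using f d ab by auto
    qed
    with elim show ?case by simp
  qed
qed

text \<open>The fractional parts are compared as real numbers, not modulo 1, so no wrap-around
  occurs: from some index on, visits of \<open>s\<close> to a slightly smaller interval are visits
  of \<open>t\<close> to the given one.\<close>

lemma uniformly_distributed_mod1_perturb:
  assumes ud: "uniformly_distributed_mod1 s"
    and lim: "(\<lambda>n. frac (t n) - frac (s n)) \<longlonglongrightarrow> 0"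
  shows "uniformly_distributed_mod1 t"
proof (rule uniformly_distributed_mod1I)
  fix a b e :: real assume ab: "0 \<le> a" "a < b" "b \<le> 1" "0 < e"
  \<comment> \<open>Of the four \<open>d\<close> that make up \<open>e\<close>, two pay for
    shrinking the interval, one for the limit of its frequency and one for
    \<open>n0 / N\<close>.\<close>
  define d where "d = min (e/4) ((b - a)/2)"
  have d: "0 < d" "4 * d \<le> e" "2 * d \<le> b - a"
    using ab by (simp_all add: d_def min_def)
  have "\<forall>\<^sub>F n in sequentially. dist (frac (t n) - frac (s n)) 0 < d"
    using lim d by (intro tendstoD)
  then obtain n0 where n0: "\<And>n. n \<ge> n0 \<Longrightarrow> \<bar>frac (t n) - frac (s n)\<bar> < d"
    by (auto simp: eventually_sequentially dist_real_def)
  have "freq s {a + d..<b - d} \<longlonglongrightarrow> (b - d) - (a + d)"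
    using ab d by (intro uniformly_distributed_mod1D[OF ud]) auto
  then have "\<forall>\<^sub>F N in sequentially. b - a - 3 * d < freq s {a + d..<b - d} N"
    by (rule order_tendstoD) (use d in simp)
  moreover have "(\<lambda>N. real n0 / real N) \<longlonglongrightarrow> 0"
    by (rule lim_const_over_n)
  then have "\<forall>\<^sub>F N in sequentially. real n0 / real N < d"
    by (rule order_tendstoD) (use d in simp)
  ultimately show "\<forall>\<^sub>F N in sequentially. b - a - e \<le> freq t {a..<b} N"
  proof eventually_elim
    case (elim N)
    have "freq s {a + d..<b - d} N \<le> freq t {a..<b} N + real n0 / real N"
    proof (rule freq_le_freq_plus)
      fix n assume "n \<ge> n0" "frac (s n) \<in> {a + d..<b - d}"
      then show "frac (t n) \<in> {a..<b}" using n0[of n] by auto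
    qed
    with elim d show ?case by linarith
  qed
qed

section \<open>Preimages of intervals under multiplication modulo 1\<close>

lemma frac_scale_iff:
  fixes r a b x :: real
  assumes r: "0 < r" and ab: "0 \<le> a" "b \<le> 1" "b + real_of_int \<lceil>r\<rceil> - 1 \<le> r"
    and x: "0 \<le> x" "x < 1"
  shows "frac (r * x) \<in> {a..<b} \<longleftrightarrow> x \<in> (\<Union>j<nat \<lceil>r\<rceil>. {(a + real j) / r..<(b + real j) / r})"
proof
  assume f: "frac (r * x) \<in> {a..<b}"
  define j where "j = nat \<lfloor>r * x\<rfloor>"
  have nn: "0 \<le> r * x" using r x by simp
  have rj: "r * x = real j + frac (r * x)"
    using nn by (simp add: j_def frac_def)
  have "r * x < r" using r x by simp
  then have "real j < real (nat \<lceil>r\<rceil>)"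
    using rj frac_ge_0[of "r * x"] r by linarith
  then have "j < nat \<lceil>r\<rceil>" by simp
  moreover have "x \<in> {(a + real j) / r..<(b + real j) / r}"
    using f rj r by (simp add: field_simps)
  ultimately show "x \<in> (\<Union>j<nat \<lceil>r\<rceil>. {(a + real j) / r..<(b + real j) / r})" by blast
next
  assume "x \<in> (\<Union>j<nat \<lceil>r\<rceil>. {(a + real j) / r..<(b + real j) / r})"
  then obtain j :: nat where "x \<in> {(a + real j) / r..<(b + real j) / r}" by blast
  then have j: "a + real j \<le> r * x" "r * x < b + real j"
    using r by (auto simp: field_simps)
  then have "\<lfloor>r * x\<rfloor> = int j" using ab by (intro floor_unique) auto
  then show "frac (r * x) \<in> {a..<b}" using j by (simp add: frac_def)
qed

lemma disjoint_family_scaled_intervals: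
  fixes r a b :: real
  assumes r: "0 < r" and ab: "0 \<le> a" "b \<le> 1"
  shows "disjoint_family_on (\<lambda>j::nat. {(a + real j) / r..<(b + real j) / r}) J"
  unfolding disjoint_family_on_def
proof (intro ballI impI)
  fix i j :: nat assume "i \<noteq> j"
  show "{(a + real i) / r..<(b + real i) / r} \<inter> {(a + real j) / r..<(b + real j) / r} = {}"
  proof (rule ccontr)
    assume "\<not> ?thesis"
    then have "(a + real i) / r < (b + real j) / r" "(a + real j) / r < (b + real i) / r"
      by auto
    then have "a + real i < b + real j" "a + real j < b + real i"
      using r by (simp_all only: divide_less_cancel)
    with ab have "real i < real (Suc j)" "real j < real (Suc i)"
      by (linarith, linarith)
    with \<open>i \<noteq> j\<close> show False by simp
  qed
qed

text \<open>The bound on \<open>b\<close> reads \<open>b \<le> 1\<close> for integral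
  \<open>r\<close> and \<open>b \<le> frac r\<close> otherwise. It makes even the last branch,
  \<open>j = \<lceil>r\<rceil> - 1\<close>, run through all of \<open>[a, b)\<close> before
  \<open>r * x\<close> reaches \<open>r\<close>. So there are \<open>\<lceil>r\<rceil>\<close> full
  preimages of length \<open>(b - a) / r\<close> each: the limit is \<open>b - a\<close> for
  integral \<open>r\<close> and larger otherwise, if \<open>a < b\<close>.\<close>

lemma freq_scale_tendsto:
  fixes r a b :: real
  assumes ud: "uniformly_distributed_mod1 s" and r: "0 < r"
    and ab: "0 \<le> a" "a \<le> b" "b + real_of_int \<lceil>r\<rceil> - 1 \<le> r"
  shows "freq (\<lambda>n. r * frac (s n)) {a..<b} \<longlonglongrightarrow> real_of_int \<lceil>r\<rceil> * (b - a) / r"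
proof -
  define K where "K = nat \<lceil>r\<rceil>"
  have K: "real K = real_of_int \<lceil>r\<rceil>" using r by (simp add: K_def)
  define A where "A = (\<lambda>j::nat. {(a + real j) / r..<(b + real j) / r})"
  have b1: "b \<le> 1" using ab(3) le_of_int_ceiling[of r] by linarith
  have iff: "frac (r * frac x) \<in> {a..<b} \<longleftrightarrow> frac x \<in> (\<Union>j<K. A j)" for x
    unfolding K_def A_def using r ab b1
    by (intro frac_scale_iff) (simp_all add: frac_ge_0 frac_lt_1)
  have disj: "disjoint_family_on A {..<K}"
    unfolding A_def using r ab b1 by (intro disjoint_family_scaled_intervals)
  have "(\<lambda>N. \<Sum>j<K. freq s (A j) N) \<longlonglongrightarrow> (\<Sum>j<K. (b - a) / r)"
  proof (rule tendsto_sum)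
    fix j assume "j \<in> {..<K}"
    then have j: "b + real j \<le> r" using K ab by auto
    have "b / r + real j / r \<le> 1"
      using j r by (simp flip: add_divide_distrib)
    then show "freq s (A j) \<longlonglongrightarrow> (b - a) / r"
      unfolding A_def using r ab
      by (intro uniformly_distributed_mod1D[OF ud] divide_right_mono)
        (simp_all add: diff_divide_distrib add_divide_distrib)
  qed
  moreover have "freq (\<lambda>n. r * frac (s n)) {a..<b} = (\<lambda>N. \<Sum>j<K. freq s (A j) N)"
    unfolding freq_UNION[OF finite_lessThan disj, of s, symmetric]
    by (intro ext freq_cong iff)
  ultimately show ?thesis using K by simp
qed

lemma frac_of_int_mult_frac: "frac (of_int k * frac x) = frac (of_int k * (x::real))"
proof -
  have "of_int k * x = of_int (k * \<lfloor>x\<rfloor>) + of_int k * frac x"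
    by (simp add: frac_def algebra_simps)
  then show ?thesis
    by (simp add: frac_def flip: of_int_add of_int_mult)
qed

lemma uniformly_distributed_mod1_of_int_mult:
  assumes ud: "uniformly_distributed_mod1 s" and r: "r \<noteq> 0"
  shows "uniformly_distributed_mod1 (\<lambda>n. of_int r * s n)"
proof -
  have pos: "uniformly_distributed_mod1 (\<lambda>n. of_int k * s n)" if "k > 0" for k
    unfolding uniformly_distributed_mod1_freq
  proof (intro allI impI)
    fix a b :: real assume "0 \<le> a" "a \<le> b" "b \<le> 1"
    then have "freq (\<lambda>n. of_int k * frac (s n)) {a..<b} \<longlonglongrightarrow> b - a"
      using freq_scale_tendsto[OF ud, of "of_int k" a b] that by simp
    moreover have "freq (\<lambda>n. of_int k * frac (s n)) {a..<b} = freq (\<lambda>n. of_int k * s n) {a..<b}"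
      by (rule ext, rule freq_cong) (simp add: frac_of_int_mult_frac)
    ultimately show "freq (\<lambda>n. of_int k * s n) {a..<b} \<longlonglongrightarrow> b - a" by simp
  qed
  show ?thesis
  proof (cases "r > 0")
    case False
    then have "uniformly_distributed_mod1 (\<lambda>n. - (of_int (- r) * s n))"
      using r by (intro uniformly_distributed_mod1_uminus pos) simp
    then show ?thesis by simp
  qed (rule pos)
qed

text \<open>The test interval \<open>[0, frac r)\<close> is the part of the circle that is hit by
  the incomplete last branch, so its frequency is too large by the factor
  \<open>\<lceil>r\<rceil> / r > 1\<close>.\<close>

lemma not_uniformly_distributed_mod1_scale:
  fixes r :: real
  assumes ud: "uniformly_distributed_mod1 s" and r: "0 < r" "r \<notin> \<int>"
  shows "\<not> uniformly_distributed_mod1 (\<lambda>n. r * frac (s n))"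
proof
  assume ud': "uniformly_distributed_mod1 (\<lambda>n. r * frac (s n))"
  define b where "b = frac r"
  have b: "0 < b" "b < 1" using r by (simp_all add: b_def frac_lt_1)
  have c: "real_of_int \<lceil>r\<rceil> = r - b + 1"
    using r by (simp add: b_def frac_def ceiling_altdef Ints_def)
      (metis Ints_of_int r(2))
  have "freq (\<lambda>n. r * frac (s n)) {0..<b} \<longlonglongrightarrow> (r - b + 1) * (b - 0) / r"
    using freq_scale_tendsto[OF ud r(1), of 0 b] b c by simp
  moreover have "freq (\<lambda>n. r * frac (s n)) {0..<b} \<longlonglongrightarrow> b - 0"
    using b by (intro uniformly_distributed_mod1D[OF ud']) auto
  ultimately have "(r - b + 1) * (b - 0) / r = b - 0"
    using LIMSEQ_unique by blast
  then have "(r - b + 1) * b = r * b" using r by (simp add: field_simps)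
  then show False using b by simp
qed

text \<open>Applied later also to the branching numbers \<open>M\<close> of the Cantor set, which
  may equal 1.\<close>

definition base_prod :: "(nat \<Rightarrow> nat) \<Rightarrow> nat \<Rightarrow> nat" where
  "base_prod q n = (\<Prod>j=1..n. q j)"

lemma base_prod_0 [simp]: "base_prod q 0 = 1"
  by (simp add: base_prod_def)

lemma base_prod_Suc: "base_prod q (Suc n) = base_prod q n * q (Suc n)"
  by (simp add: base_prod_def)

lemma DN_iff: "x \<in> DN q \<longleftrightarrow> uniformly_distributed_mod1 (\<lambda>n. real (base_prod q n) * x)"
  by (simp add: DN_def T_Q_def uniformly_distributed_mod1_def base_prod_def)

lemma DN_of_int_mult:
  assumes "x \<in> DN q" "r \<noteq> 0"
  shows "of_int r * x \<in> DN q"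
  using uniformly_distributed_mod1_of_int_mult[of "\<lambda>n. real (base_prod q n) * x" r] assms
  by (simp add: DN_iff mult_ac)

section \<open>Almost every number is normal\<close>

lemma sets_frac_strip [measurable]:
  "{x \<in> {\<alpha>..<\<beta>}. frac (K * x) \<in> {a..<b}} \<in> sets (lborel :: real measure)"
  unfolding frac_def by measurable

lemma fmeasurable_Ico: "{l..<u::real} \<in> fmeasurable lborel"
  by (cases "l \<le> u") (auto simp: fmeasurable_def)

text \<open>At most \<open>K * (\<beta> - \<alpha>) + 2\<close> periods of length
  \<open>1 / K\<close> meet \<open>[\<alpha>, \<beta>)\<close>, and each contributes at most
  \<open>(b - a) / K\<close>.\<close>

lemma measure_frac_strip_le:
  fixes \<alpha> \<beta> K a b :: real
  assumes "0 < K" "\<alpha> \<le> \<beta>" "0 \<le> a" "a \<le> b" "b \<le> 1"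
  shows "measure lborel {x \<in> {\<alpha>..<\<beta>}. frac (K * x) \<in> {a..<b}} \<le> (b - a) * (\<beta> - \<alpha>) + 2 / K"
proof -
  define J where "J = {\<lfloor>K * \<alpha>\<rfloor>..\<lfloor>K * \<beta>\<rfloor>}"
  have le: "K * \<alpha> \<le> K * \<beta>" using assms by simp
  have "{x \<in> {\<alpha>..<\<beta>}. frac (K * x) \<in> {a..<b}} \<subseteq> (\<Union>j\<in>J. {(of_int j + a) / K..<(of_int j + b) / K})"
  proof
    fix x assume x: "x \<in> {x \<in> {\<alpha>..<\<beta>}. frac (K * x) \<in> {a..<b}}"
    then have "\<lfloor>K * x\<rfloor> \<in> J"
      using assms unfolding J_def by (auto intro!: floor_mono)
    moreover have "x \<in> {(of_int \<lfloor>K * x\<rfloor> + a) / K..<(of_int \<lfloor>K * x\<rfloor> + b) / K}"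
      using x assms
      by (simp add: frac_def pos_divide_le_eq pos_less_divide_eq mult.commute[of x] algebra_simps)
    ultimately show "x \<in> (\<Union>j\<in>J. {(of_int j + a) / K..<(of_int j + b) / K})" by blast
  qed
  then have "measure lborel {x \<in> {\<alpha>..<\<beta>}. frac (K * x) \<in> {a..<b}}
      \<le> measure lborel (\<Union>j\<in>J. {(of_int j + a) / K..<(of_int j + b) / K})"
    by (intro measure_mono_fmeasurable fmeasurable.finite_UN fmeasurable_Ico sets_frac_strip)
       (simp_all only: J_def finite_atLeastAtMost_int)
  also have "\<dots> \<le> (\<Sum>j\<in>J. measure lborel {(of_int j + a) / K..<(of_int j + b) / K})"
    by (intro measure_UNION_le) (auto simp: J_def)
  also have "\<dots> = (\<Sum>j\<in>J. (b - a) / K)"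
    using assms by (intro sum.cong refl) (simp add: divide_right_mono diff_divide_distrib add_divide_distrib)
  also have "\<dots> = real (card J) * ((b - a) / K)" by simp
  also have "\<dots> \<le> (K * (\<beta> - \<alpha>) + 2) * ((b - a) / K)"
  proof (rule mult_right_mono)
    have "\<lfloor>K * \<alpha>\<rfloor> \<le> \<lfloor>K * \<beta>\<rfloor>" using le by (rule floor_mono)
    then have "real (card J) = of_int (\<lfloor>K * \<beta>\<rfloor> - \<lfloor>K * \<alpha>\<rfloor> + 1)"
      by (simp add: J_def)
    also have "\<dots> \<le> K * (\<beta> - \<alpha>) + 2"
      unfolding right_diff_distrib by simp linarith
    finally show "real (card J) \<le> K * (\<beta> - \<alpha>) + 2" .
  qed (use assms in simp)
  also have "\<dots> \<le> (b - a) * (\<beta> - \<alpha>) + 2 / K"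
  proof -
    have "(K * (\<beta> - \<alpha>) + 2) * ((b - a) / K) = (b - a) * (\<beta> - \<alpha>) + 2 * (b - a) / K"
      using assms by (simp add: field_simps)
    moreover have "2 * (b - a) / K \<le> 2 / K"
      using assms by (intro divide_right_mono) auto
    ultimately show ?thesis by linarith
  qed
  finally show ?thesis .
qed

text \<open>No boundary error arises here, since the unit interval consists of exactly
  \<open>K\<close> whole periods.\<close>

lemma measure_frac_strip_unit:
  fixes a b :: real and K :: nat
  assumes "0 < K" "0 \<le> a" "a \<le> b" "b \<le> 1"
  shows "measure lborel {x \<in> {0..<1}. frac (real K * x) \<in> {a..<b}} = b - a"
proof -
  let ?A = "\<lambda>j::nat. {(a + real j) / real K..<(b + real j) / real K}"
  have iff: "frac (real K * x) \<in> {a..<b} \<longleftrightarrow> x \<in> (\<Union>j<K. ?A j)" if "0 \<le> x" "x < 1" for x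
    using frac_scale_iff[of "real K" a b x] that assms by simp
  have sub: "?A j \<subseteq> {0..<1}" if "j < K" for j
  proof -
    have "b + real j \<le> real K" using that assms by linarith
    then have "0 \<le> (a + real j) / real K" "(b + real j) / real K \<le> 1" using assms by simp_all
    then show ?thesis by (simp add: ivl_subset)
  qed
  have "{x \<in> {0..<1}. frac (real K * x) \<in> {a..<b}} = (\<Union>j<K. ?A j)"
  proof (intro set_eqI iffI)
    fix x assume "x \<in> {x \<in> {0..<1}. frac (real K * x) \<in> {a..<b}}"
    then show "x \<in> (\<Union>j<K. ?A j)" using iff[of x] unfolding mem_Collect_eq by simp
  next
    fix x assume x: "x \<in> (\<Union>j<K. ?A j)"
    then have "x \<in> {0..<1}" using sub by blast
    then show "x \<in> {x \<in> {0..<1}. frac (real K * x) \<in> {a..<b}}" using iff[of x] x by simp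
  qed
  also have "measure lborel \<dots> = (\<Sum>j<K. measure lborel (?A j))"
    using assms by (intro measure_finite_Union disjoint_family_scaled_intervals)
      (auto simp: divide_right_mono)
  also have "\<dots> = (\<Sum>j<K. (b - a) / real K)"
    using assms by (intro sum.cong refl) (simp add: divide_right_mono diff_divide_distrib add_divide_distrib)
  also have "\<dots> = b - a" using assms by simp
  finally show ?thesis .
qed

text \<open>The condition at \<open>m\<close> cuts out \<open>m\<close> intervals of length
  \<open>(b - a) / m\<close>. The estimate for one interval applies to each of them, so its boundary
  error \<open>2 / K\<close> occurs \<open>m\<close> times. The two events are thus nearly
  uncorrelated from above when \<open>K\<close> is much larger than \<open>m\<close>.\<close>

lemma measure_frac_strip_Int_le:
  fixes a b :: real and m K :: nat
  assumes "0 < m" "0 < K" and ab: "0 \<le> a" "a \<le> b" "b \<le> 1"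
  shows "measure lborel {x \<in> {0..<1}. frac (real m * x) \<in> {a..<b} \<and> frac (real K * x) \<in> {a..<b}}
           \<le> (b - a)\<^sup>2 + 2 * real m / real K"
proof -
  let ?l = "\<lambda>j::nat. (a + real j) / real m" and ?u = "\<lambda>j::nat. (b + real j) / real m"
  let ?B = "\<lambda>j. {x \<in> {?l j..<?u j}. frac (real K * x) \<in> {a..<b}}"
  have "frac (real m * x) \<in> {a..<b} \<longleftrightarrow> x \<in> (\<Union>j<m. {?l j..<?u j})" if "0 \<le> x" "x < 1" for x
    using frac_scale_iff[of "real m" a b x] that assms by simp
  then have "{x \<in> {0..<1}. frac (real m * x) \<in> {a..<b} \<and> frac (real K * x) \<in> {a..<b}} \<subseteq> (\<Union>j<m. ?B j)"
    unfolding subset_iff mem_Collect_eq UN_iff atLeastLessThan_iff by blast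
  moreover have "?B j \<in> fmeasurable lborel" for j
    by (rule fmeasurableI2[OF fmeasurable_Ico[of "?l j" "?u j"] _ sets_frac_strip]) auto
  moreover have "{x \<in> {0..<1}. frac (real m * x) \<in> {a..<b} \<and> frac (real K * x) \<in> {a..<b}} \<in> sets lborel"
    unfolding frac_def by measurable
  ultimately have "measure lborel {x \<in> {0..<1}. frac (real m * x) \<in> {a..<b} \<and> frac (real K * x) \<in> {a..<b}}
       \<le> measure lborel (\<Union>j<m. ?B j)"
    by (intro measure_mono_fmeasurable fmeasurable.finite_UN) auto
  also have "\<dots> \<le> (\<Sum>j<m. measure lborel (?B j))"
    by (intro measure_UNION_le sets_frac_strip finite_lessThan)
  also have "\<dots> \<le> (\<Sum>j<m. (b - a) * (?u j - ?l j) + 2 / real K)"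
    using assms by (intro sum_mono measure_frac_strip_le) (auto intro: divide_right_mono)
  also have "\<dots> = (\<Sum>j<m. (b - a)\<^sup>2 / real m + 2 / real K)"
    by (intro sum.cong refl) (simp add: power2_eq_square flip: diff_divide_distrib)
  also have "\<dots> = (b - a)\<^sup>2 + 2 * real m / real K"
    using assms by (simp add: distrib_left)
  finally show ?thesis .
qed

section \<open>Second moment of the counting error\<close>

lemma base_prod_pos: "basic_seq q \<Longrightarrow> base_prod q n > 0"
  by (auto simp: base_prod_def basic_seq_def intro!: prod_pos)

lemma base_prod_Suc_ge: "basic_seq q \<Longrightarrow> 2 * base_prod q n \<le> base_prod q (Suc n)"
  by (simp add: base_prod_Suc basic_seq_def)

lemma two_power_le_base_prod:
  assumes "basic_seq q"
  shows "2 ^ n \<le> base_prod q n"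
proof (induction n)
  case (Suc n)
  then show ?case using base_prod_Suc_ge[OF assms, of n] by simp
qed simp

text \<open>The products at least double at each step. This bounds the sum of the covariances of one
  visit with all earlier ones by a constant.\<close>

lemma sum_base_prod_le:
  assumes "basic_seq q"
  shows "(\<Sum>m<N. base_prod q m) \<le> base_prod q N"
proof (induction N)
  case (Suc N)
  then show ?case using base_prod_Suc_ge[OF assms, of N] by simp
qed simp

text \<open>Not divided by \<open>N\<close>, so that it is a sum of centred terms with increments
  bounded by 1.\<close>

definition discrepancy :: "(nat \<Rightarrow> nat) \<Rightarrow> real \<Rightarrow> real \<Rightarrow> nat \<Rightarrow> real \<Rightarrow> real" where
  "discrepancy q a b N x =
     (\<Sum>n<N. indicator {a..<b} (frac (real (base_prod q n) * x)) - (b - a))"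

lemma discrepancy_Suc:
  "discrepancy q a b (Suc N) x = discrepancy q a b N x
     + (indicator {a..<b} (frac (real (base_prod q N) * x)) - (b - a))"
  by (simp add: discrepancy_def)

lemma discrepancy_freq:
  "N > 0 \<Longrightarrow> discrepancy q a b N x / real N = freq (\<lambda>n. real (base_prod q n) * x) {a..<b} N - (b - a)"
  by (simp add: discrepancy_def freq_def sum_subtractf diff_divide_distrib indicator_def
      sum.If_cases Int_def cong: conj_cong)

lemma borel_measurable_discrepancy [measurable]:
  "discrepancy q a b N \<in> borel_measurable borel"
  unfolding discrepancy_def frac_def by measurable

lemma abs_discrepancy_diff_le:
  assumes "0 \<le> a" "a \<le> b" "b \<le> 1"
  shows "\<bar>discrepancy q a b (Suc N) x - discrepancy q a b N x\<bar> \<le> 1"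
  using assms by (auto simp: discrepancy_Suc indicator_def)

lemma abs_discrepancy_le:
  assumes "0 \<le> a" "a \<le> b" "b \<le> 1"
  shows "\<bar>discrepancy q a b N x\<bar> \<le> real N"
proof (induction N)
  case (Suc N)
  then show ?case using abs_discrepancy_diff_le[OF assms, of q N x] by simp
qed (simp add: discrepancy_def)

text \<open>Induction on \<open>N\<close>: expanding the square at \<open>Suc N\<close> adds twice
  the covariance with the previous sum, which is at most 2 by the geometric growth of the base
  products, and a diagonal term of at most 1. Hence 5 per step.\<close>

lemma integral_discrepancy_square_le:
  fixes a b :: real
  assumes q: "basic_seq q" and ab: "0 \<le> a" "a \<le> b" "b \<le> 1"
  defines "M \<equiv> restrict_space lborel {0..<1::real}"
  shows "(\<integral>x. (discrepancy q a b N x)\<^sup>2 \<partial>M) \<le> 5 * real N"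
proof -
  interpret finite_measure M
    by (rule finite_measureI) (simp add: M_def emeasure_restrict_space space_restrict_space)
  define c where "c = b - a"
  define f where "f = (\<lambda>n x. indicator {a..<b} (frac (real (base_prod q n) * x)) :: real)"
  have sp: "space M = {0..<1}" by (simp add: M_def space_restrict_space)
  have mM: "measure M A = measure lborel A" if "A \<subseteq> {0..<1}" for A
    unfolding M_def using that by (intro measure_restrict_space) auto
  have borelM: "g \<in> borel_measurable M" if "g \<in> borel_measurable borel" for g :: "real \<Rightarrow> real"
    using that unfolding M_def by (intro measurable_restrict_space1) simp
  have fb: "f n \<in> borel_measurable borel" for n
    unfolding f_def frac_def by measurable
  have intM: "integrable M g" if "g \<in> borel_measurable borel" "\<And>x. \<bar>g x\<bar> \<le> B" for g :: "real \<Rightarrow> real" and B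
    by (rule integrable_const_bound[of _ B]) (simp_all add: that borelM)
  have f01: "f n x = 0 \<or> f n x = 1" for n x by (auto simp: f_def indicator_def)
  have f_le: "\<bar>f n x\<bar> \<le> 1" for n x using f01[of n x] by auto
  have if1: "integrable M (f n)" for n by (rule intM[OF fb f_le])
  have if2: "integrable M (\<lambda>x. f m x * f n x)" for m n
    by (rule intM[of _ 1]) (use fb f_le in \<open>auto simp: abs_mult mult_le_one\<close>)
  have P: "base_prod q n > 0" for n using q by (rule base_prod_pos)
  have ef: "(\<integral>x. f n x \<partial>M) = c" for n
  proof -
    have "(\<integral>x. f n x \<partial>M) = (\<integral>x. indicator {x \<in> {0..<1}. frac (real (base_prod q n) * x) \<in> {a..<b}} x \<partial>M)"
      by (intro Bochner_Integration.integral_cong) (auto simp: f_def sp indicator_def)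
    also have "\<dots> = measure M {x \<in> {0..<1}. frac (real (base_prod q n) * x) \<in> {a..<b}}"
      by (simp add: sp Int_absorb2 Collect_subset[THEN order_trans] subset_eq)
    also have "\<dots> = c"
      using measure_frac_strip_unit[OF P[of n] ab] by (subst mM) (auto simp: c_def)
    finally show ?thesis .
  qed
  have eff: "(\<integral>x. f m x * f n x \<partial>M) \<le> c\<^sup>2 + 2 * real (base_prod q m) / real (base_prod q n)" for m n
  proof -
    let ?S = "{x \<in> {0..<1}. frac (real (base_prod q m) * x) \<in> {a..<b} \<and> frac (real (base_prod q n) * x) \<in> {a..<b}}"
    have "(\<integral>x. f m x * f n x \<partial>M) = (\<integral>x. indicator ?S x \<partial>M)"
      by (intro Bochner_Integration.integral_cong) (auto simp: f_def sp indicator_def)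
    also have "\<dots> = measure M (?S \<inter> space M)" by simp
    also have "?S \<inter> space M = ?S" by (auto simp: sp)
    also have "measure M ?S \<le> c\<^sup>2 + 2 * real (base_prod q m) / real (base_prod q n)"
      using measure_frac_strip_Int_le[OF P[of m] P[of n] ab] by (subst mM) (auto simp: c_def)
    finally show ?thesis .
  qed
  have m1: "measure M (space M) = 1" by (simp add: sp mM)
  have cov: "(\<integral>x. (f m x - c) * (f n x - c) \<partial>M) \<le> 2 * real (base_prod q m) / real (base_prod q n)" for m n
  proof -
    have "(\<integral>x. (f m x - c) * (f n x - c) \<partial>M) = (\<integral>x. f m x * f n x - c * f m x - c * f n x + c\<^sup>2 \<partial>M)"
      by (intro Bochner_Integration.integral_cong) (auto simp: algebra_simps power2_eq_square)
    also have "\<dots> = (\<integral>x. f m x * f n x \<partial>M) - c * c - c * c + c\<^sup>2"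
      using if1 if2 by (simp add: ef m1)
    finally show ?thesis using eff[of m n] by (simp add: power2_eq_square)
  qed
  have disc: "discrepancy q a b N = (\<lambda>x. \<Sum>n<N. f n x - c)" for N
    by (rule ext) (simp add: discrepancy_def f_def c_def)
  have gb: "\<bar>f n x - c\<bar> \<le> 1" for n x using f01[of n x] ab by (auto simp: c_def)
  have ig: "integrable M (\<lambda>x. (f m x - c) * (f n x - c))" for m n
    by (rule intM[of _ 1]) (use fb gb in \<open>auto simp: abs_mult mult_le_one\<close>)
  have iS: "integrable M (\<lambda>x. (discrepancy q a b N x)\<^sup>2)" for N
    by (rule intM[of _ "(real N)\<^sup>2"])
      (use abs_discrepancy_le[OF ab] in \<open>simp_all add: abs_le_square_iff[symmetric]\<close>)
  show ?thesis
  proof (induction N)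
    case 0
    then show ?case by (simp add: discrepancy_def)
  next
    case (Suc N)
    have iSg: "integrable M (\<lambda>x. discrepancy q a b N x * (f N x - c))"
      unfolding disc sum_distrib_right by (intro Bochner_Integration.integrable_sum ig)
    have "(\<integral>x. discrepancy q a b N x * (f N x - c) \<partial>M) = (\<Sum>m<N. \<integral>x. (f m x - c) * (f N x - c) \<partial>M)"
      unfolding disc sum_distrib_right by (intro Bochner_Integration.integral_sum ig)
    also have "\<dots> \<le> (\<Sum>m<N. 2 * real (base_prod q m) / real (base_prod q N))"
      by (intro sum_mono cov)
    also have "\<dots> = 2 * real (\<Sum>m<N. base_prod q m) / real (base_prod q N)"
      by (simp add: sum_distrib_left sum_divide_distrib)
    also have "\<dots> \<le> 2 * real (base_prod q N) / real (base_prod q N)"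
      using sum_base_prod_le[OF q, of N]
      by (intro divide_right_mono mult_left_mono) (simp_all only: of_nat_le_iff of_nat_0_le_iff zero_le_numeral)
    also have "\<dots> = 2" using P[of N] by simp
    finally have cross: "(\<integral>x. discrepancy q a b N x * (f N x - c) \<partial>M) \<le> 2" .
    have diag: "(\<integral>x. (f N x - c) * (f N x - c) \<partial>M) \<le> 1"
    proof -
      have "(\<integral>x. (f N x - c) * (f N x - c) \<partial>M) \<le> (\<integral>x. 1 \<partial>M)"
        using gb by (intro integral_mono ig) (simp_all add: abs_square_le_1 flip: power2_eq_square)
      then show ?thesis by (simp add: m1)
    qed
    have "(\<integral>x. (discrepancy q a b (Suc N) x)\<^sup>2 \<partial>M)
       = (\<integral>x. (discrepancy q a b N x)\<^sup>2 + 2 * (discrepancy q a b N x * (f N x - c)) + (f N x - c) * (f N x - c) \<partial>M)"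
      by (intro Bochner_Integration.integral_cong)
        (auto simp: discrepancy_Suc f_def c_def power2_eq_square algebra_simps)
    also have "\<dots> = (\<integral>x. (discrepancy q a b N x)\<^sup>2 \<partial>M) + 2 * (\<integral>x. discrepancy q a b N x * (f N x - c) \<partial>M)
        + (\<integral>x. (f N x - c) * (f N x - c) \<partial>M)"
      using iS iSg ig by simp
    finally show ?case using Suc cross diag by simp
  qed
qed

text \<open>A sequence with bounded increments moves by at most \<open>2 k\<close> between \<open>k\<^sup>2\<close> and
  \<open>(k + 1)\<^sup>2\<close>, so averages along squares control all averages.\<close>
lemma averages_tendsto_0_from_squares:
  fixes s :: "nat \<Rightarrow> real"
  assumes step: "\<And>n. \<bar>s (Suc n) - s n\<bar> \<le> 1"
    and sq: "(\<lambda>k. s (k\<^sup>2) / real (k\<^sup>2)) \<longlonglongrightarrow> 0"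
  shows "(\<lambda>n. s n / real n) \<longlonglongrightarrow> 0"
proof -
  have lip: "\<bar>s (m + d) - s m\<bar> \<le> real d" for m d
  proof (induction d)
    case (Suc d)
    then show ?case using step[of "m + d"] by simp
  qed simp
  define k where "k n = nat \<lfloor>sqrt (real n)\<rfloor>" for n
  have k_le: "real (k n) \<le> sqrt (real n)" and k_gt: "sqrt (real n) < real (k n) + 1" for n
    unfolding k_def by auto
  have le: "(k n)\<^sup>2 \<le> n" for n
  proof -
    have "(real (k n))\<^sup>2 \<le> (sqrt (real n))\<^sup>2" using k_le[of n] by (intro power_mono) auto
    then have "real ((k n)\<^sup>2) \<le> real n" by simp
    then show ?thesis by (simp only: of_nat_le_iff)
  qed
  have gt: "n < (k n + 1)\<^sup>2" for n
  proof -
    have "(sqrt (real n))\<^sup>2 < (real (k n) + 1)\<^sup>2" using k_gt[of n] by (intro power_strict_mono) auto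
    then have "real n < real ((k n + 1)\<^sup>2)" by (simp add: add.commute)
    then show ?thesis by (simp only: of_nat_less_iff)
  qed
  have k_lim: "filterlim k at_top sequentially"
    unfolding k_def
    by (intro filterlim_compose[OF filterlim_nat_sequentially] filterlim_compose[OF filterlim_floor_sequentially]
        filterlim_compose[OF sqrt_at_top] filterlim_real_sequentially)
  have "(\<lambda>k. \<bar>s (k\<^sup>2) / real (k\<^sup>2)\<bar> + 2 * (1 / real k)) \<longlonglongrightarrow> \<bar>0\<bar> + 2 * 0"
    by (intro tendsto_intros sq lim_1_over_n)
  then have "(\<lambda>k. \<bar>s (k\<^sup>2) / real (k\<^sup>2)\<bar> + 2 * (1 / real k)) \<longlonglongrightarrow> 0" by simp
  then have lim: "(\<lambda>n. \<bar>s ((k n)\<^sup>2) / real ((k n)\<^sup>2)\<bar> + 2 * (1 / real (k n))) \<longlonglongrightarrow> 0"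
    by (rule filterlim_compose[OF _ k_lim])
  show ?thesis
  proof (rule Lim_null_comparison[OF _ lim])
    show "\<forall>\<^sub>F n in sequentially. norm (s n / real n) \<le> \<bar>s ((k n)\<^sup>2) / real ((k n)\<^sup>2)\<bar> + 2 * (1 / real (k n))"
      using eventually_gt_at_top[of 0]
    proof eventually_elim
      case (elim n)
      have k0: "k n > 0"
      proof (rule ccontr)
        assume "\<not> k n > 0"
        with gt[of n] elim show False by simp
      qed
      have "n - (k n)\<^sup>2 \<le> 2 * k n" using gt[of n] by (simp add: power2_eq_square)
      then have "real (n - (k n)\<^sup>2) \<le> real (2 * k n)" by (simp only: of_nat_le_iff)
      moreover have "\<bar>s n - s ((k n)\<^sup>2)\<bar> \<le> real (n - (k n)\<^sup>2)"
        using lip[of "(k n)\<^sup>2" "n - (k n)\<^sup>2"] le[of n] by (simp only: le_add_diff_inverse)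
      ultimately have "\<bar>s n - s ((k n)\<^sup>2)\<bar> \<le> real (2 * k n)" by linarith
      then have "\<bar>s n\<bar> \<le> \<bar>s ((k n)\<^sup>2)\<bar> + 2 * real (k n)" by simp
      then have "norm (s n / real n) \<le> (\<bar>s ((k n)\<^sup>2)\<bar> + 2 * real (k n)) / real n"
        using elim by (simp add: divide_right_mono)
      also have "\<dots> \<le> (\<bar>s ((k n)\<^sup>2)\<bar> + 2 * real (k n)) / real ((k n)\<^sup>2)"
        using le[of n] k0 elim by (intro divide_left_mono mult_pos_pos) (simp_all only: of_nat_le_iff, auto)
      also have "\<dots> = \<bar>s ((k n)\<^sup>2) / real ((k n)\<^sup>2)\<bar> + 2 * (1 / real (k n))"
        using k0 by (simp add: add_divide_distrib power2_eq_square)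
      finally show ?case .
    qed
  qed
qed

text \<open>Along squares the normalised second moments are at most \<open>5 / k^2\<close> and hence
  summable. So the series of squared errors converges almost everywhere and its terms tend to 0;
  bounded increments then extend this from the squares to all \<open>n\<close>.\<close>

lemma AE_freq_tendsto:
  fixes a b :: real
  assumes q: "basic_seq q" and ab: "0 \<le> a" "a \<le> b" "b \<le> 1"
  shows "AE x in restrict_space lborel {0..<1}. freq (\<lambda>n. real (base_prod q n) * x) {a..<b} \<longlonglongrightarrow> b - a"
proof -
  define M where "M = restrict_space lborel {0..<1::real}"
  interpret finite_measure M
    by (rule finite_measureI) (simp add: M_def emeasure_restrict_space space_restrict_space)
  define D where "D = (\<lambda>k x. (discrepancy q a b (k\<^sup>2) x / real (k\<^sup>2))\<^sup>2)"
  have mD [measurable]: "D k \<in> borel_measurable M" for k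
    unfolding M_def D_def by (intro measurable_restrict_space1) simp
  have iD: "integrable M (D k)" for k
  proof (rule integrable_const_bound[of _ 1])
    have "\<bar>discrepancy q a b (k\<^sup>2) x / real (k\<^sup>2)\<bar> \<le> 1" for x
      using abs_discrepancy_le[OF ab, of q "k\<^sup>2" x] by (cases "k = 0") (simp_all add: divide_le_eq)
    then show "AE x in M. norm (D k x) \<le> 1"
      by (simp add: D_def abs_square_le_1)
  qed (rule mD)
  \<comment> \<open>For \<open>k = 0\<close> both sides are 0, as division by 0 yields 0.\<close>
  have bound: "(\<integral>\<^sup>+x. ennreal (D k x) \<partial>M) \<le> ennreal (5 * (1 / real k ^ 2))" for k
  proof (cases "k = 0")
    case True
    then show ?thesis by (simp add: D_def)
  next
    case False
    have "(\<integral>\<^sup>+x. ennreal (D k x) \<partial>M) = ennreal (\<integral>x. D k x \<partial>M)"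
      by (intro nn_integral_eq_integral iD) (simp add: D_def)
    also have "(\<integral>x. D k x \<partial>M) = (\<integral>x. (discrepancy q a b (k\<^sup>2) x)\<^sup>2 \<partial>M) / (real (k\<^sup>2))\<^sup>2"
      by (simp add: D_def power_divide)
    also have "\<dots> \<le> 5 * real (k\<^sup>2) / (real (k\<^sup>2))\<^sup>2"
      unfolding M_def by (intro divide_right_mono integral_discrepancy_square_le[OF q ab]) simp
    also have "\<dots> = 5 * (1 / real k ^ 2)"
      using False by (simp add: power2_eq_square)
    finally show ?thesis by (simp add: ennreal_leI)
  qed
  have summ: "summable (\<lambda>k. 5 * (1 / real k ^ 2))"
    using inverse_power_summable[of 2, where 'a = real] by (intro summable_mult) (simp add: inverse_eq_divide)
  have "(\<integral>\<^sup>+x. (\<Sum>k. ennreal (D k x)) \<partial>M) = (\<Sum>k. \<integral>\<^sup>+x. ennreal (D k x) \<partial>M)"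
    by (intro nn_integral_suminf) measurable
  also have "\<dots> \<le> (\<Sum>k. ennreal (5 * (1 / real k ^ 2)))"
    by (intro suminf_le bound) auto
  also have "\<dots> = ennreal (\<Sum>k. 5 * (1 / real k ^ 2))"
    using summ by (intro suminf_ennreal2) auto
  finally have "(\<integral>\<^sup>+x. (\<Sum>k. ennreal (D k x)) \<partial>M) \<noteq> \<infinity>"
    by (auto simp: top_unique)
  then have "AE x in M. (\<Sum>k. ennreal (D k x)) \<noteq> \<infinity>"
    by (intro nn_integral_PInf_AE) measurable
  then have "AE x in M. freq (\<lambda>n. real (base_prod q n) * x) {a..<b} \<longlonglongrightarrow> b - a"
  proof eventually_elim
    case (elim x)
    then have "summable (\<lambda>k. D k x)"
      by (intro summable_suminf_not_top) (auto simp: D_def)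
    then have "(\<lambda>k. D k x) \<longlonglongrightarrow> 0" by (rule summable_LIMSEQ_zero)
    then have "(\<lambda>k. sqrt (D k x)) \<longlonglongrightarrow> sqrt 0" by (intro tendsto_intros)
    then have "(\<lambda>k. discrepancy q a b (k\<^sup>2) x / real (k\<^sup>2)) \<longlonglongrightarrow> 0"
      unfolding D_def real_sqrt_abs real_sqrt_zero by (simp only: tendsto_rabs_zero_iff)
    then have "(\<lambda>n. discrepancy q a b n x / real n) \<longlonglongrightarrow> 0"
      by (intro averages_tendsto_0_from_squares abs_discrepancy_diff_le ab)
    then have "(\<lambda>n. freq (\<lambda>n. real (base_prod q n) * x) {a..<b} n - (b - a)) \<longlonglongrightarrow> 0"
      by (rule Lim_transform_eventually)
         (use eventually_gt_at_top[of 0] in eventually_elim, rule discrepancy_freq)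
    then show ?case by (simp only: LIM_zero_iff)
  qed
  then show ?thesis by (simp only: M_def)
qed

text \<open>Only countably many exceptional null sets may be united, hence the rational endpoints.
  Any other interval contains a rational one that is almost as long, which yields the lower bound on
  its frequency.\<close>

lemma AE_DN:
  assumes q: "basic_seq q"
  shows "AE x in restrict_space lborel {0..<1}. x \<in> DN q"
proof -
  let ?f = "\<lambda>x. freq (\<lambda>n. real (base_prod q n) * x)"
  have "AE x in restrict_space lborel {0..<1}. \<forall>p\<in>{p \<in> \<rat> \<times> \<rat>. 0 \<le> fst p \<and> fst p \<le> snd p \<and> snd p \<le> 1}.
      ?f x {fst p..<snd p} \<longlonglongrightarrow> snd p - fst p"
    by (intro AE_ball_countable' AE_freq_tendsto[OF q] countable_subset[OF _ countable_SIGMA[OF countable_rat countable_rat]])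
       auto
  then show ?thesis
  proof eventually_elim
    case (elim x)
    show ?case
      unfolding DN_iff
    proof (rule uniformly_distributed_mod1I)
      fix a b e :: real assume ab: "0 \<le> a" "a < b" "b \<le> 1" "0 < e"
      define d where "d = min (e/3) ((b - a)/3)"
      have d: "0 < d" "3 * d \<le> e" "3 * d \<le> b - a" using ab by (simp_all add: d_def min_def)
      obtain a' where a': "a' \<in> \<rat>" "a < a'" "a' < a + d" using Rats_dense_in_real[of a "a + d"] d by auto
      obtain b' where b': "b' \<in> \<rat>" "b - d < b'" "b' < b" using Rats_dense_in_real[of "b - d" b] d by auto
      have "?f x {a'..<b'} \<longlonglongrightarrow> b' - a'"
        using elim[THEN bspec, of "(a', b')"] a' b' ab d by simp
      then have "\<forall>\<^sub>F N in sequentially. b - a - e < ?f x {a'..<b'} N"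
        by (rule order_tendstoD) (use a' b' d in linarith)
      then show "\<forall>\<^sub>F N in sequentially. b - a - e \<le> ?f x {a..<b} N"
      proof eventually_elim
        case (elim N)
        have "?f x {a'..<b'} N \<le> ?f x {a..<b} N + real 0 / real N"
          by (rule freq_le_freq_plus) (use a' b' in auto)
        with elim show ?case by simp
      qed
    qed
  qed
qed

section \<open>From the unit interval to the whole line\<close>

lemma DN_add_of_int_iff: "x + of_int k \<in> DN q \<longleftrightarrow> x \<in> DN q"
proof -
  have "frac (real (base_prod q n) * (x + of_int k)) = frac (real (base_prod q n) * x)" for n
  proof -
    have "real (base_prod q n) * (x + of_int k) = real (base_prod q n) * x + of_int (int (base_prod q n) * k)"
      by (simp add: distrib_left)
    then show ?thesis by (simp only: frac_def floor_add_int[symmetric])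
  qed
  then show ?thesis by (simp add: DN_iff uniformly_distributed_mod1_def)
qed

lemma negligible_not_DN:
  assumes q: "basic_seq q"
  shows "negligible (- DN q)"
proof -
  have "AE x in lborel. x \<in> {0..<1} \<longrightarrow> x \<in> DN q"
    using AE_DN[OF q] by (subst (asm) AE_restrict_space_iff) auto
  then obtain N where N: "N \<in> null_sets lborel" "{x. \<not> (x \<in> {0..<1} \<longrightarrow> x \<in> DN q)} \<subseteq> N"
    by (auto simp: eventually_ae_filter)
  then have "negligible N"
    by (simp add: negligible_iff_null_sets null_sets_completionI)
  then have "negligible (\<Union>k::int. (+) (of_int k) ` N)"
    by (intro negligible_countable_Union) (auto intro: negligible_translation)
  moreover have "- DN q \<subseteq> (\<Union>k::int. (+) (of_int k) ` N)"
  proof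
    fix x assume "x \<in> - DN q"
    then have "frac x \<notin> DN q"
      using DN_add_of_int_iff[of "frac x" "\<lfloor>x\<rfloor>" q] by (simp add: frac_def)
    then have "frac x \<in> N" using N(2) frac_ge_0[of x] frac_lt_1[of x] by auto
    moreover have "x = of_int \<lfloor>x\<rfloor> + frac x" by (simp add: frac_def)
    ultimately show "x \<in> (\<Union>k::int. (+) (of_int k) ` N)" by blast
  qed
  ultimately show ?thesis by (rule negligible_subset)
qed

lemma negligible_scale_not_DN:
  fixes r :: real
  assumes q: "basic_seq q" and r: "r \<noteq> 0"
  shows "negligible {x. r * x \<notin> DN q}"
proof -
  have "negligible ((\<lambda>x. x / r) ` (- DN q))"
    using negligible_not_DN[OF q]
    by (intro negligible_differentiable_image_negligible)
       (auto intro!: derivative_intros simp: differentiable_on_def r)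
  moreover have "{x. r * x \<notin> DN q} \<subseteq> (\<lambda>x. x / r) ` (- DN q)"
  proof
    fix x assume "x \<in> {x. r * x \<notin> DN q}"
    then have "r * x \<in> - DN q" "x = r * x / r" using r by auto
    then show "x \<in> (\<lambda>x. x / r) ` (- DN q)" by blast
  qed
  ultimately show ?thesis by (rule negligible_subset)
qed

text \<open>Supplies the number \<open>x0\<close> whose orbit the points of the Cantor set
  imitate.\<close>

lemma DN_nonempty:
  assumes "basic_seq q"
  shows "\<exists>x. x \<in> DN q"
proof (rule ccontr)
  assume "\<nexists>x. x \<in> DN q"
  then have "- DN q = UNIV" by auto
  with negligible_not_DN[OF assms] show False by simp
qed

section \<open>Hausdorff measure on the line\<close>

lemma unbounded_harmonic_sums: "\<exists>k. B < (\<Sum>j<k. 1 / (real j + 1))"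
proof (rule ccontr)
  assume "\<not> ?thesis"
  then have "summable (\<lambda>j. 1 / (real j + 1))"
    by (intro summableI_nonneg_bounded[of _ B]) (auto simp: not_less)
  then have "summable (\<lambda>j. inverse (real (Suc j)))" by (simp add: inverse_eq_divide add.commute)
  then have "summable (\<lambda>j. inverse (real j))" by (subst (asm) summable_Suc_iff)
  then show False using not_summable_harmonic by blast
qed

text \<open>For \<open>s > 1\<close> the whole line is null: lay intervals of lengths \<open>c / (j + 1)\<close> end to end in
  both directions. They cover because the harmonic series diverges, while the sum of the \<open>s\<close>-th
  powers of their lengths is proportional to \<open>c\<^sup>s\<close>.\<close>
lemma hausdorff_outer_measure_eq_0:
  assumes s: "s > 1"
  shows "hausdorff_outer_measure s A = 0"
proof -
  define Z where "Z = (\<Sum>i. (real i + 1) powr - s)"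
  have summ: "summable (\<lambda>i. (real i + 1) powr - s)"
  proof -
    have "summable (\<lambda>i. real (Suc i) powr - s)"
      using s by (subst summable_Suc_iff) (simp add: summable_real_powr_iff)
    then show ?thesis by (simp add: add.commute)
  qed
  have Z0: "Z \<ge> 0" unfolding Z_def by (intro suminf_nonneg summ) simp
  define H where "H k = (\<Sum>j<k. 1 / (real j + 1))" for k
  have H_Suc: "H (Suc k) = H k + 1 / (real k + 1)" for k by (simp add: H_def)
  have H0: "H 0 = 0" by (simp add: H_def)
  have between: "\<exists>k. H k \<le> y \<and> y \<le> H (Suc k)" if "y \<ge> 0" for y
  proof -
    define k where "k = (LEAST k. y < H k)"
    have ex: "\<exists>k. y < H k" unfolding H_def by (rule unbounded_harmonic_sums)
    then have k: "y < H k" unfolding k_def by (rule LeastI_ex)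
    have "k \<noteq> 0" using k that H0 by (intro notI) simp
    then obtain m where m: "k = Suc m" using not0_implies_Suc by blast
    have "\<not> y < H m" using m unfolding k_def by (metis lessI not_less_Least)
    then show ?thesis using k m by (intro exI[of _ m]) auto
  qed
  have "hausdorff_content s \<delta> A \<le> 0" if \<delta>: "\<delta> > 0" for \<delta>
  proof (rule ennreal_le_epsilon)
    fix e :: real assume e: "0 < e"
    \<comment> \<open>Chosen so that \<open>2 * c\<close> bounds all diameters by
      \<open>\<delta>\<close> and \<open>(2 * c) powr s * Z \<le> e\<close>; adding 1 to
      \<open>Z\<close> keeps the denominator positive.\<close>
    define c where "c = min \<delta> ((e / (Z + 1)) powr (1 / s)) / 2"
    have c: "c > 0" using e \<delta> Z0 by (simp add: c_def min_def)
    have cd: "2 * c \<le> \<delta>" by (simp add: c_def)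
    have "(2 * c) powr s \<le> ((e / (Z + 1)) powr (1 / s)) powr s"
      using c s by (intro powr_mono2) (auto simp: c_def)
    also have "\<dots> = e / (Z + 1)" using s e Z0 by (simp add: powr_powr)
    finally have "(2 * c) powr s * Z \<le> e / (Z + 1) * Z" using Z0 by (rule mult_right_mono)
    also have "\<dots> \<le> e" using Z0 e by (simp add: field_simps)
    finally have ce: "(2 * c) powr s * Z \<le> e" .
    \<comment> \<open>Even indices cover the right half-line and odd ones the left. Interleaving
      them costs the factor 2 in \<open>2 * c / (i + 1)\<close>.\<close>
    define U where "U i = (let k = i div 2 in if even i then {c * H k..c * H (Suc k)}
        else {- (c * H (Suc k))..- (c * H k)})" for i
    have diam: "diameter (U i) \<le> 2 * c * (1 / (real i + 1))" and bdd: "bounded (U i)" for i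
    proof -
      define k where "k = i div 2"
      have "i + 1 \<le> 2 * (k + 1)" by (simp add: k_def)
      then have "real (i + 1) \<le> real (2 * (k + 1))" by (simp only: of_nat_le_iff)
      then have ik: "1 / (real k + 1) \<le> 2 / (real i + 1)" by (simp add: field_simps)
      have "diameter (U i) = c * (1 / (real k + 1))"
        using c by (simp add: U_def Let_def H_Suc k_def[symmetric] distrib_left not_less divide_less_0_iff)
      also have "\<dots> \<le> c * (2 / (real i + 1))" using ik c by (intro mult_left_mono) auto
      finally show "diameter (U i) \<le> 2 * c * (1 / (real i + 1))" by (simp add: mult_ac)
      show "bounded (U i)" by (simp add: U_def Let_def)
    qed
    have diam_\<delta>: "diameter (U i) \<le> \<delta>" for i
    proof -
      have "2 * c * (1 / (real i + 1)) \<le> 2 * c * 1" using c by (intro mult_left_mono) auto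
      then show ?thesis using diam[of i] cd by linarith
    qed
    have cover: "A \<subseteq> (\<Union>i. U i)"
    proof
      fix x
      obtain k where k: "H k \<le> \<bar>x\<bar> / c" "\<bar>x\<bar> / c \<le> H (Suc k)"
        using between[of "\<bar>x\<bar> / c"] c by auto
      then have k': "c * H k \<le> \<bar>x\<bar>" "\<bar>x\<bar> \<le> c * H (Suc k)"
        using c by (simp_all add: pos_le_divide_eq pos_divide_le_eq mult.commute)
      show "x \<in> (\<Union>i. U i)"
      proof (cases "x \<ge> 0")
        case True
        then have "x \<in> U (2 * k)" using k' by (simp add: U_def Let_def)
        then show ?thesis by blast
      next
        case False
        then have "x \<in> U (2 * k + 1)" using k' by (simp add: U_def Let_def)
        then show ?thesis by blast
      qed
    qed
    have "hausdorff_content s \<delta> A \<le> (\<Sum>i. ennreal (diameter (U i) powr s))"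
      unfolding hausdorff_content_def using cover bdd diam_\<delta> by (intro INF_lower) auto
    also have "\<dots> \<le> (\<Sum>i. ennreal ((2 * c) powr s * (real i + 1) powr - s))"
    proof (intro suminf_le ennreal_leI)
      fix i
      have "diameter (U i) powr s \<le> (2 * c * (1 / (real i + 1))) powr s"
        using s bdd by (intro powr_mono2 diam diameter_ge_0) auto
      also have "\<dots> = (2 * c) powr s * (1 / (real i + 1)) powr s"
        by (rule powr_mult)
      also have "(1 / (real i + 1)) powr s = (real i + 1) powr - s"
        by (simp add: powr_minus_divide powr_divide)
      finally show "diameter (U i) powr s \<le> (2 * c) powr s * (real i + 1) powr - s" .
    qed auto
    also have "\<dots> = ennreal (\<Sum>i. (2 * c) powr s * (real i + 1) powr - s)"
      by (intro suminf_ennreal2 summable_mult summ) simp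
    also have "\<dots> = ennreal ((2 * c) powr s * Z)"
      unfolding Z_def by (subst suminf_mult[OF summ]) simp
    also have "\<dots> \<le> ennreal e" using ce by (rule ennreal_leI)
    finally show "hausdorff_content s \<delta> A \<le> 0 + ennreal e" by simp
  qed
  then show ?thesis
    unfolding hausdorff_outer_measure_def by (auto intro!: SUP_eq_const antisym)
qed

text \<open>The hypothesis says that the inverse of \<open>X\<close> is Hoelder of exponent
  \<open>s\<close>. A set \<open>U i\<close> of a cover of \<open>A\<close> therefore pulls back
  into an interval of length \<open>2 * C * diameter (U i) powr s\<close>; these intervals cover
  \<open>[0, 1)\<close>, so the sum of the powers is at least \<open>1 / (2 * C)\<close>.\<close>

lemma hausdorff_outer_measure_neq_0:
  fixes X :: "real \<Rightarrow> real"
  assumes C: "C > 0"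
    and XA: "\<And>y. 0 \<le> y \<Longrightarrow> y < 1 \<Longrightarrow> X y \<in> A"
    and holder: "\<And>y y'. 0 \<le> y \<Longrightarrow> y < 1 \<Longrightarrow> 0 \<le> y' \<Longrightarrow> y' < 1 \<Longrightarrow> \<bar>y - y'\<bar> \<le> C * \<bar>X y - X y'\<bar> powr s"
    and s: "s > 0"
  shows "hausdorff_outer_measure s A \<noteq> 0"
proof
  assume "hausdorff_outer_measure s A = 0"
  moreover have "hausdorff_content s 1 A \<le> hausdorff_outer_measure s A"
    unfolding hausdorff_outer_measure_def by (rule SUP_upper) simp
  ultimately have "hausdorff_content s 1 A < ennreal (1 / (2 * C))" using C by simp
  then obtain U :: "nat \<Rightarrow> real set" where U: "A \<subseteq> (\<Union>i. U i)" "\<And>i. bounded (U i)"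
    and sum: "(\<Sum>i. ennreal (diameter (U i) powr s)) < ennreal (1 / (2 * C))"
    unfolding hausdorff_content_def INF_less_iff by auto
  define d where "d i = C * diameter (U i) powr s" for i
  have d0: "d i \<ge> 0" for i using C by (simp add: d_def)
  have "\<exists>z. \<forall>y. 0 \<le> y \<and> y < 1 \<and> X y \<in> U i \<longrightarrow> y \<in> {z - d i..z + d i}" for i
  proof (cases "\<exists>z. 0 \<le> z \<and> z < 1 \<and> X z \<in> U i")
    case True
    then obtain z where z: "0 \<le> z" "z < 1" "X z \<in> U i" by blast
    have "\<bar>y - z\<bar> \<le> d i" if y: "0 \<le> y" "y < 1" "X y \<in> U i" for y
    proof -
      have "\<bar>X y - X z\<bar> \<le> diameter (U i)"
        using diameter_bounded_bound[OF U(2) y(3) z(3)] by (simp add: dist_real_def)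
      then have "C * \<bar>X y - X z\<bar> powr s \<le> d i"
        unfolding d_def using C s by (intro mult_left_mono powr_mono2) auto
      with holder[OF y(1,2) z(1,2)] show ?thesis by linarith
    qed
    then show ?thesis by (intro exI[of _ z]) (fastforce simp: abs_le_iff)
  qed auto
  then obtain z where z: "\<And>i y. 0 \<le> y \<Longrightarrow> y < 1 \<Longrightarrow> X y \<in> U i \<Longrightarrow> y \<in> {z i - d i..z i + d i}"
    by metis
  have "{0..<1::real} \<subseteq> (\<Union>i. {z i - d i..z i + d i})"
  proof
    fix y :: real assume "y \<in> {0..<1}"
    then have y: "0 \<le> y" "y < 1" by auto
    then obtain i where "X y \<in> U i" using XA U(1) by blast
    with z[OF y] show "y \<in> (\<Union>i. {z i - d i..z i + d i})" by blast
  qed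
  then have "emeasure lborel {0..<1::real} \<le> emeasure lborel (\<Union>i. {z i - d i..z i + d i})"
    by (intro emeasure_mono) auto
  also have "\<dots> \<le> (\<Sum>i. emeasure lborel {z i - d i..z i + d i})"
    by (intro emeasure_subadditive_countably) auto
  also have "\<dots> = (\<Sum>i. ennreal (2 * C) * ennreal (diameter (U i) powr s))"
    using d0 C by (intro suminf_cong) (simp add: d_def ennreal_mult[symmetric] mult_ac)
  also have "\<dots> = ennreal (2 * C) * (\<Sum>i. ennreal (diameter (U i) powr s))"
    by (rule ennreal_suminf_cmult)
  also have "\<dots> < ennreal (2 * C) * ennreal (1 / (2 * C))"
    using sum C by (intro ennreal_mult_strict_left_mono) auto
  also have "\<dots> = 1" using C by (simp add: ennreal_mult[symmetric] ennreal_1[symmetric] del: ennreal_1)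
  finally show False by simp
qed

text \<open>Every exponent above 1 lies in the set whose infimum is taken, and by hypothesis none
  below 1 does.\<close>

lemma hausdorff_dim_eq_1:
  assumes "\<And>s. 0 < s \<Longrightarrow> s < 1 \<Longrightarrow> hausdorff_outer_measure s A \<noteq> 0"
  shows "hausdorff_dim A = 1"
  unfolding hausdorff_dim_def
proof (rule antisym)
  let ?S = "{s. 0 < s \<and> hausdorff_outer_measure s A = 0}"
  have bdd: "bdd_below ?S" by (rule bdd_belowI[of _ 0]) auto
  show "Inf ?S \<le> 1"
  proof (rule dense_ge)
    fix s :: real assume "1 < s"
    then show "Inf ?S \<le> s"
      using bdd by (intro cInf_lower) (auto simp: hausdorff_outer_measure_eq_0)
  qed
  show "1 \<le> Inf ?S"
  proof (rule cInf_greatest)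
    show "?S \<noteq> {}" using hausdorff_outer_measure_eq_0[of 2 A] by (auto intro!: exI[of _ 2])
    fix s assume "s \<in> ?S"
    then show "1 \<le> s" using assms[of s] by force
  qed
qed

section \<open>Expansions with prescribed digits\<close>

text \<open>Horner's scheme for the integer with mixed-radix digits \<open>E 1, ..., E n\<close>,
  most significant first.\<close>

primrec digit_value :: "(nat \<Rightarrow> nat) \<Rightarrow> (nat \<Rightarrow> nat) \<Rightarrow> nat \<Rightarrow> nat" where
  "digit_value q E 0 = 0"
| "digit_value q E (Suc n) = q (Suc n) * digit_value q E n + E (Suc n)"

text \<open>The value of the Cantor series with terms \<open>E n / base_prod q n\<close>, as the
  supremum of its increasing partial sums.\<close>

definition expansion :: "(nat \<Rightarrow> nat) \<Rightarrow> (nat \<Rightarrow> nat) \<Rightarrow> real" where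
  "expansion q E = (SUP n. real (digit_value q E n) / real (base_prod q n))"

text \<open>Nested intervals: the truncations \<open>L\<close> increase, and the right endpoints
  \<open>R\<close>, one unit of the last place higher, decrease. The upper bound is not strict
  because all later digits may be maximal.\<close>

lemma expansion_bounds:
  assumes q: "basic_seq q" and E: "\<And>n. E (Suc n) < q (Suc n)"
  shows "real (digit_value q E n) \<le> real (base_prod q n) * expansion q E"
    and "real (base_prod q n) * expansion q E \<le> real (digit_value q E n) + 1"
proof -
  let ?P = "\<lambda>n. real (base_prod q n)"
  have P: "?P n > 0" for n using base_prod_pos[OF q] by simp
  have q0: "real (q (Suc n)) > 0" for n using E[of n] by simp
  define L where "L n = real (digit_value q E n) / ?P n" for n
  define R where "R n = (real (digit_value q E n) + 1) / ?P n" for n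
  have incL: "L m \<le> L n" if "m \<le> n" for m n
  proof (rule lift_Suc_mono_le[OF _ that])
    fix n show "L n \<le> L (Suc n)"
      using P[of n] q0[of n] by (simp add: L_def base_prod_Suc field_simps)
  qed
  have decR: "R n \<le> R m" if "m \<le> n" for m n
  proof (rule lift_Suc_antimono_le[OF _ that])
    fix n
    have "real (E (Suc n)) + 1 \<le> real (q (Suc n))" using E[of n] by linarith
    then have "(real (E (Suc n)) + 1) * ?P n \<le> real (q (Suc n)) * ?P n"
      using P[of n] by (intro mult_right_mono) auto
    then show "R (Suc n) \<le> R n"
      using P[of n] q0[of n] by (simp add: R_def base_prod_Suc field_simps)
  qed
  have LR: "L m \<le> R n" for m n
  proof -
    have "L m \<le> L (max m n)" by (intro incL) simp
    also have "\<dots> \<le> R (max m n)" using P by (simp add: L_def R_def divide_right_mono less_imp_le)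
    also have "\<dots> \<le> R n" by (intro decR) simp
    finally show ?thesis .
  qed
  have "bdd_above (range L)" using LR[of _ 0] by (auto intro!: bdd_aboveI[of _ "R 0"])
  then have "L n \<le> expansion q E"
    unfolding expansion_def L_def[symmetric] by (intro cSUP_upper) auto
  then show "real (digit_value q E n) \<le> ?P n * expansion q E"
    using P[of n] by (simp add: L_def pos_divide_le_eq mult.commute)
  have "expansion q E \<le> R n"
    unfolding expansion_def L_def[symmetric] by (intro cSUP_least LR) auto
  then show "?P n * expansion q E \<le> real (digit_value q E n) + 1"
    using P[of n] by (simp add: R_def pos_le_divide_eq mult.commute)
qed

text \<open>Digits \<open>q - 1\<close> are excluded, which rules out the ambiguous expansions: the integer part of
  \<open>q\<^sub>1 \<cdots> q\<^sub>n x\<close> is exactly the value of the first \<open>n\<close> digits.\<close>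
lemma frac_expansion:
  assumes q: "basic_seq q" and E: "\<And>n. E (Suc n) + 2 \<le> q (Suc n)"
  shows "frac (real (base_prod q n) * expansion q E) = real (base_prod q n) * expansion q E - real (digit_value q E n)"
    and "\<bar>frac (real (base_prod q n) * expansion q E) - real (E (Suc n)) / real (q (Suc n))\<bar> \<le> 1 / real (q (Suc n))"
proof -
  have E': "E (Suc n) < q (Suc n)" for n using E[of n] by simp
  define t where "t n = real (base_prod q n) * expansion q E - real (digit_value q E n)" for n
  have t: "0 \<le> t n" "t n \<le> 1" for n
    using expansion_bounds[where q=q and E=E and n=n, OF q E'] by (simp_all add: t_def)
  have q0: "real (q (Suc n)) > 0" using E[of n] by simp
  \<comment> \<open>Shifting by one digit gives both claims: with \<open>t (Suc n)\<close> in
    \<open>[0, 1]\<close> it places \<open>t n\<close> within \<open>1 / q (Suc n)\<close> of the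
    digit quotient, and a digit of at most \<open>q (Suc n) - 2\<close> forces
    \<open>t n < 1\<close>.\<close>
  have "real (q (Suc n)) * t n = real (E (Suc n)) + t (Suc n)"
    by (simp add: t_def base_prod_Suc algebra_simps)
  then have tn: "t n = real (E (Suc n)) / real (q (Suc n)) + t (Suc n) / real (q (Suc n))"
    using q0 by (simp add: field_simps)
  have "t n \<le> (real (E (Suc n)) + 1) / real (q (Suc n))"
    using t[of "Suc n"] q0 by (simp add: tn add_divide_distrib divide_right_mono)
  also have "\<dots> < 1"
  proof -
    have "real (E (Suc n) + 2) \<le> real (q (Suc n))" using E by (simp only: of_nat_le_iff)
    then show ?thesis using q0 by simp
  qed
  finally have t1: "t n < 1" .
  have fr: "frac (real (base_prod q n) * expansion q E) = t n"
    using t[of n] t1 by (intro frac_unique_iff[THEN iffD2]) (auto simp: t_def)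
  then show "frac (real (base_prod q n) * expansion q E) = real (base_prod q n) * expansion q E - real (digit_value q E n)"
    by (simp add: t_def)
  show "\<bar>frac (real (base_prod q n) * expansion q E) - real (E (Suc n)) / real (q (Suc n))\<bar> \<le> 1 / real (q (Suc n))"
    using t[of "Suc n"] q0 unfolding fr tn by (simp add: divide_right_mono)
qed

lemma dvd_digit_value:
  assumes "\<And>n. b dvd E (Suc n)"
  shows "b dvd digit_value q E n"
  by (induction n) (use assms in auto)

lemma infinite_in_limit_filterlim_Suc:
  "infinite_in_limit q \<Longrightarrow> filterlim (\<lambda>n. real (q (Suc n))) at_top sequentially"
  unfolding infinite_in_limit_def
  by (intro filterlim_compose[OF filterlim_real_sequentially] filterlim_compose[OF _ filterlim_Suc])

text \<open>The orbit of the expansion at time \<open>n\<close> is within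
  \<open>1 / q (Suc n)\<close> of its next digit divided by \<open>q (Suc n)\<close>. As
  \<open>q\<close> tends to infinity, this quotient determines the orbit asymptotically.\<close>

lemma expansion_mem_DN:
  assumes q: "basic_seq q" and lim: "infinite_in_limit q" and x0: "x0 \<in> DN q"
    and E: "\<And>n. E (Suc n) + 2 \<le> q (Suc n)"
    and close: "(\<lambda>n. real (E (Suc n)) / real (q (Suc n)) - frac (real (base_prod q n) * x0)) \<longlonglongrightarrow> 0"
  shows "expansion q E \<in> DN q"
  unfolding DN_iff
proof (rule uniformly_distributed_mod1_perturb)
  show "uniformly_distributed_mod1 (\<lambda>n. real (base_prod q n) * x0)"
    using x0 by (simp add: DN_iff)
  have "filterlim (\<lambda>n. real (q (Suc n))) at_top sequentially"
    by (rule infinite_in_limit_filterlim_Suc[OF lim])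
  then have "(\<lambda>n. 1 / real (q (Suc n))) \<longlonglongrightarrow> 0"
    by (intro tendsto_divide_0[OF tendsto_const] filterlim_at_top_imp_at_infinity)
  then have "(\<lambda>n. frac (real (base_prod q n) * expansion q E) - real (E (Suc n)) / real (q (Suc n))) \<longlonglongrightarrow> 0"
    by (rule Lim_null_comparison[rotated]) (use frac_expansion(2)[OF q E] in auto)
  from tendsto_add[OF this close]
  show "(\<lambda>n. frac (real (base_prod q n) * expansion q E) - frac (real (base_prod q n) * x0)) \<longlonglongrightarrow> 0"
    by simp
qed

text \<open>When all digits are divisible by \<open>b\<close>, multiplication by \<open>r \<in> \<int> / b\<close> does not see the
  integer part, so \<open>T\<^sub>n (r x)\<close> is the fractional part of \<open>r T\<^sub>n x\<close>.\<close>
lemma scaled_expansion_not_mem_DN: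
  fixes r :: real
  assumes q: "basic_seq q" and r: "r \<notin> \<int>" and b: "r * real b \<in> \<int>"
    and E: "\<And>n. E (Suc n) + 2 \<le> q (Suc n)" "\<And>n. b dvd E (Suc n)"
    and DN: "expansion q E \<in> DN q"
  shows "r * expansion q E \<notin> DN q"
proof -
  have pos: "r * expansion q E \<notin> DN q" if r: "0 < r" "r \<notin> \<int>" "r * real b \<in> \<int>" for r
  proof
    let ?x = "expansion q E"
    assume "r * ?x \<in> DN q"
    then have ud: "uniformly_distributed_mod1 (\<lambda>n. real (base_prod q n) * (r * ?x))"
      by (simp add: DN_iff)
    have "frac (real (base_prod q n) * (r * ?x)) = frac (r * frac (real (base_prod q n) * ?x))" for n
    proof -
      obtain c where c: "digit_value q E n = b * c"
        using dvd_digit_value[where E = E, OF E(2)] by (rule dvdE)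
      obtain m where m: "r * real b = of_int m" using r(3) by (rule Ints_cases)
      have "r * real (digit_value q E n) = of_int (m * int c)"
        by (simp add: c m flip: mult.assoc)
      moreover have "real (base_prod q n) * (r * ?x)
          = r * frac (real (base_prod q n) * ?x) + r * real (digit_value q E n)"
        unfolding frac_expansion(1)[OF q E(1)] by (simp add: algebra_simps)
      ultimately have "real (base_prod q n) * (r * ?x) = r * frac (real (base_prod q n) * ?x) + of_int (m * int c)"
        by simp
      then show ?thesis by (simp only: frac_def floor_add_int[symmetric])
    qed
    with ud have "uniformly_distributed_mod1 (\<lambda>n. r * frac (real (base_prod q n) * ?x))"
      by (simp add: uniformly_distributed_mod1_def)
    moreover have "\<not> uniformly_distributed_mod1 (\<lambda>n. r * frac (real (base_prod q n) * ?x))"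
      using DN r by (intro not_uniformly_distributed_mod1_scale) (simp_all add: DN_iff)
    ultimately show False by blast
  qed
  show ?thesis
  proof (cases "r > 0")
    case False
    have "r \<noteq> 0" using r by auto
    then have "- r * expansion q E \<notin> DN q"
      using False r b by (intro pos) auto
    then show ?thesis using DN_of_int_mult[of "r * expansion q E" q "- 1"] by auto
  qed (use r b in \<open>simp add: pos\<close>)
qed

section \<open>A Cantor set of exceptional numbers\<close>

lemma real_base_prod_pos:
  assumes "\<And>n. M n \<ge> 1"
  shows "real (base_prod M n) > 0"
proof (induction n)
  case (Suc n)
  then show ?case using assms[of "Suc n"] by (simp add: base_prod_Suc)
qed simp

text \<open>The number of the level-\<open>n\<close> cell, of length
  \<open>1 / base_prod M n\<close>, that contains \<open>y\<close>; its residue modulo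
  \<open>M n\<close> is the \<open>n\<close>-th digit of \<open>y\<close> in base
  \<open>M\<close>.\<close>

definition index :: "(nat \<Rightarrow> nat) \<Rightarrow> real \<Rightarrow> nat \<Rightarrow> nat" where
  "index M y n = nat \<lfloor>real (base_prod M n) * y\<rfloor>"

lemma index_Suc_div:
  assumes M: "M (Suc n) \<ge> 1" and y: "0 \<le> y"
  shows "index M y (Suc n) div M (Suc n) = index M y n"
proof -
  have "\<lfloor>real (base_prod M n) * y\<rfloor> = \<lfloor>real (base_prod M (Suc n)) * y / of_int (int (M (Suc n)))\<rfloor>"
    using M by (simp add: base_prod_Suc)
  also have "\<dots> = \<lfloor>real (base_prod M (Suc n)) * y\<rfloor> div int (M (Suc n))"
    by (rule floor_divide_real_eq_div) simp
  finally show ?thesis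
    using y by (simp add: index_def nat_div_distrib)
qed

text \<open>\<open>A n\<close> is an offset; the digit \<open>b (A n + i)\<close> encodes the digit \<open>i < M n\<close> of \<open>y\<close> in base \<open>M\<close>.
  The map \<open>y \<mapsto> expansion q (cantor_digit b A M y)\<close> parametrises a Cantor set by \<open>[0, 1)\<close>.\<close>
definition cantor_digit :: "nat \<Rightarrow> (nat \<Rightarrow> nat) \<Rightarrow> (nat \<Rightarrow> nat) \<Rightarrow> real \<Rightarrow> nat \<Rightarrow> nat" where
  "cantor_digit b A M y n = b * (A n + index M y n mod M n)"

text \<open>\<open>D\<close> is the difference of the digits at the first position \<open>n + 1\<close> where \<open>y\<close> and \<open>y'\<close>
  disagree.\<close>
lemma cantor_separation:
  fixes y y' :: real
  assumes q: "basic_seq q" and b: "b \<ge> 2" and M: "\<And>n. M n \<ge> 1"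
    and lim: "filterlim (\<lambda>n. real (base_prod M n)) at_top sequentially"
    and E: "\<And>y n. cantor_digit b A M y (Suc n) < q (Suc n)"
    and y: "0 \<le> y" "y < 1" "0 \<le> y'" "y' < 1" "y \<noteq> y'"
  defines "X \<equiv> \<lambda>y. expansion q (cantor_digit b A M y)"
  obtains n D where "1 \<le> D" "D \<le> M (Suc n)"
    "real (base_prod M (Suc n)) * \<bar>y - y'\<bar> \<le> 2 * real D"
    "real D \<le> real (base_prod q (Suc n)) * \<bar>X y - X y'\<bar>"
proof -
  have idx: "real (index M z n) \<le> real (base_prod M n) * z" "real (base_prod M n) * z < real (index M z n) + 1"
    if "0 \<le> z" for z n
    using that by (simp_all add: index_def)
  \<comment> \<open>Points in the same cell on every level would be closer than every cell length,
    and these tend to 0.\<close>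
  have "\<exists>n. index M y n \<noteq> index M y' n"
  proof (rule ccontr)
    assume eq: "\<not> ?thesis"
    have "\<forall>\<^sub>F n in sequentially. 1 / \<bar>y - y'\<bar> \<le> real (base_prod M n)"
      using lim by (simp add: filterlim_at_top)
    then obtain n where "1 / \<bar>y - y'\<bar> \<le> real (base_prod M n)"
      by (auto simp: eventually_sequentially)
    then have "1 \<le> real (base_prod M n) * \<bar>y - y'\<bar>"
      using y(5) by (simp add: pos_divide_le_eq)
    also have "\<dots> = \<bar>real (base_prod M n) * y - real (base_prod M n) * y'\<bar>"
      by (simp add: abs_mult flip: right_diff_distrib)
    also have "\<dots> < 1" using idx[of y n] idx[of y' n] y eq by auto
    finally show False by simp
  qed
  then obtain n' where n': "index M y n' \<noteq> index M y' n'" "\<And>j. j < n' \<Longrightarrow> index M y j = index M y' j"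
    using exists_least_iff[of "\<lambda>n. index M y n \<noteq> index M y' n"] by blast
  have "index M y 0 = index M y' 0" using y by (simp add: index_def floor_eq_iff)
  with n'(1) obtain n where n: "n' = Suc n" by (cases n') auto
  define i where "i = int (index M y (Suc n) mod M (Suc n))"
  define i' where "i' = int (index M y' (Suc n) mod M (Suc n))"
  define D where "D = nat \<bar>i - i'\<bar>"
  have im: "0 \<le> i" "i < M (Suc n)" "0 \<le> i'" "i' < M (Suc n)"
    using M[of "Suc n"] by (simp_all add: i_def i'_def)
  have dec: "int (index M z (Suc n)) = int (M (Suc n)) * int (index M z n) + int (index M z (Suc n) mod M (Suc n))"
    if "0 \<le> z" for z
    using index_Suc_div[where M=M and n=n and y=z, OF M that]
    by (metis mult_div_mod_eq of_nat_add of_nat_mult)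
  have eqn: "index M y n = index M y' n" using n'(2)[of n] n by simp
  have diff: "int (index M y (Suc n)) - int (index M y' (Suc n)) = i - i'"
    using dec[of y] dec[of y'] y eqn by (simp add: i_def i'_def)
  then have ne: "i \<noteq> i'" using n'(1) n by auto
  have D: "real D = \<bar>real_of_int (i - i')\<bar>" by (simp add: D_def)
  have D1: "1 \<le> D" using ne by (simp add: D_def)
  show ?thesis
  proof (rule that[of D n])
    show "1 \<le> D" by (rule D1)
    show "D \<le> M (Suc n)" using im by (simp add: D_def)
    let ?N = "real (base_prod M (Suc n))"
    have "real_of_int (int (index M y (Suc n)) - int (index M y' (Suc n))) = real_of_int (i - i')"
      by (simp only: diff)
    then have "real (index M y (Suc n)) - real (index M y' (Suc n)) = real_of_int (i - i')" by simp
    \<comment> \<open>The cell numbers differ by \<open>D\<close> and the positions within the cells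
      by less than 1; \<open>D + 1 \<le> 2 * D\<close> finishes the estimate.\<close>
    then have "\<bar>?N * y - ?N * y'\<bar> \<le> real D + 1"
      using idx[of y "Suc n"] idx[of y' "Suc n"] y unfolding D by linarith
    moreover have "?N * \<bar>y - y'\<bar> = \<bar>?N * y - ?N * y'\<bar>"
      by (simp add: abs_mult flip: right_diff_distrib)
    ultimately show "?N * \<bar>y - y'\<bar> \<le> 2 * real D" using D1 by simp
    let ?E = "cantor_digit b A M"
    let ?P = "real (base_prod q (Suc n))"
    have dig: "digit_value q (?E y) m = digit_value q (?E y') m" if "m \<le> n" for m
      using that n'(2) n by (induction m) (simp_all add: cantor_digit_def)
    have "int (digit_value q (?E y) (Suc n)) - int (digit_value q (?E y') (Suc n)) = int b * (i - i')"
      using dig[of n] by (simp add: cantor_digit_def i_def i'_def algebra_simps)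
    then have "real_of_int (int (digit_value q (?E y) (Suc n)) - int (digit_value q (?E y') (Suc n)))
        = real_of_int (int b * (i - i'))" by (simp only:)
    then have dv: "real (digit_value q (?E y) (Suc n)) - real (digit_value q (?E y') (Suc n))
        = real b * real_of_int (i - i')" by simp
    \<comment> \<open>The digit values differ by \<open>b * D\<close> and the tails cost at most 1,
      so \<open>b \<ge> 2\<close> leaves at least \<open>2 * D - 1 \<ge> D\<close>.\<close>
    have "2 * real D \<le> real b * real D" using b by (intro mult_right_mono) auto
    also have "\<dots> = \<bar>real b * real_of_int (i - i')\<bar>" by (simp add: D abs_mult)
    also have "\<dots> \<le> \<bar>?P * X y - ?P * X y'\<bar> + 1"
      using expansion_bounds[where q=q and E="?E y" and n="Suc n", OF q E]
        expansion_bounds[where q=q and E="?E y'" and n="Suc n", OF q E]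
      unfolding dv[symmetric] X_def by linarith
    also have "\<bar>?P * X y - ?P * X y'\<bar> = ?P * \<bar>X y - X y'\<bar>"
      by (simp add: abs_mult flip: right_diff_distrib)
    finally show "real D \<le> ?P * \<bar>X y - X y'\<bar>" using D1 by linarith
  qed
qed

text \<open>Interpolation: in \<open>D = D powr (1 - s) * D powr s\<close> the first factor is
  bounded by the number of branches and the second by the separation of the images. The hypothesis
  \<open>growth\<close> absorbs what remains.\<close>

lemma cantor_holder:
  assumes q: "basic_seq q" and b: "b \<ge> 2" and M: "\<And>n. M n \<ge> 1"
    and lim: "filterlim (\<lambda>n. real (base_prod M n)) at_top sequentially"
    and E: "\<And>y n. cantor_digit b A M y (Suc n) < q (Suc n)"
    and y: "0 \<le> y" "y < 1" "0 \<le> y'" "y' < 1"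
    and s: "0 < s" "s < 1" and C: "C > 0"
    and growth: "\<And>n. real (M (Suc n)) powr (1 - s) * real (base_prod q (Suc n)) powr s \<le> C * real (base_prod M (Suc n))"
  shows "\<bar>y - y'\<bar> \<le> 2 * C * \<bar>expansion q (cantor_digit b A M y) - expansion q (cantor_digit b A M y')\<bar> powr s"
proof (cases "y = y'")
  case True
  then show ?thesis using C by simp
next
  case False
  let ?X = "\<lambda>y. expansion q (cantor_digit b A M y)"
  obtain n D where D: "1 \<le> D" "D \<le> M (Suc n)"
    "real (base_prod M (Suc n)) * \<bar>y - y'\<bar> \<le> 2 * real D"
    "real D \<le> real (base_prod q (Suc n)) * \<bar>?X y - ?X y'\<bar>"
    using cantor_separation[OF q b M lim E y False] by blast
  let ?N = "real (base_prod M (Suc n))" and ?P = "real (base_prod q (Suc n))" and ?d = "\<bar>?X y - ?X y'\<bar>"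
  have N: "?N > 0" using M by (rule real_base_prod_pos)
  have "real D = real D powr (1 - s) * real D powr s"
    using D(1) by (simp flip: powr_add)
  also have "\<dots> \<le> real (M (Suc n)) powr (1 - s) * (?P * ?d) powr s"
    using D s by (intro mult_mono powr_mono2) auto
  also have "\<dots> = real (M (Suc n)) powr (1 - s) * ?P powr s * ?d powr s"
    by (simp add: powr_mult)
  also have "\<dots> \<le> C * ?N * ?d powr s"
    by (intro mult_right_mono growth) simp
  finally have "?N * \<bar>y - y'\<bar> \<le> ?N * (2 * C * ?d powr s)"
    using D(3) by (simp add: mult_ac)
  then show ?thesis using N by simp
qed

lemma eventually_decreasing_bounded:
  fixes W :: "nat \<Rightarrow> real"
  assumes "\<forall>\<^sub>F n in sequentially. W (Suc n) \<le> W n"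
  obtains C where "C > 0" "\<And>n. W n \<le> C"
proof -
  obtain J where J: "\<And>n. n \<ge> J \<Longrightarrow> W (Suc n) \<le> W n"
    using assms by (auto simp: eventually_sequentially)
  define C where "C = 1 + (\<Sum>i\<le>J. \<bar>W i\<bar>)"
  have small: "W n \<le> C" if "n \<le> J" for n
  proof -
    have "\<bar>W n\<bar> \<le> (\<Sum>i\<le>J. \<bar>W i\<bar>)" using that by (intro member_le_sum) auto
    then show ?thesis by (simp add: C_def)
  qed
  have "W n \<le> C" for n
  proof (induction n)
    case 0
    show ?case by (rule small) simp
  next
    case (Suc n)
    then show ?case using J[of n] small[of "Suc n"] by (cases "n \<ge> J") auto
  qed
  moreover have "C > 0" unfolding C_def by (intro add_pos_nonneg sum_nonneg) auto
  ultimately show ?thesis using that by blast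
qed

text \<open>With \<open>k n\<close> growing at most linearly and slower than a small power of \<open>q n\<close>, the factors
  \<open>q\<^sub>n\<^sup>s / M\<^sub>n\<close> tend to 0. Their product thus beats the linear factor that a single level loses.\<close>
lemma cantor_growth:
  fixes q M k :: "nat \<Rightarrow> nat" and b :: nat and s :: real
  assumes q: "basic_seq q" and lim: "infinite_in_limit q" and s: "0 < s" "s < 1" and b: "b \<ge> 2"
    and M: "\<And>n. M n \<ge> 1"
    and k: "\<And>n. 1 \<le> k (Suc n)" "\<And>n. k (Suc n) \<le> Suc n"
      "\<And>n. real (k (Suc n)) \<le> real (q (Suc n)) powr ((1 - s) / 2)"
    and qM: "\<And>n. q (Suc n) \<le> 2 * b * k (Suc n) * M (Suc n)"
  obtains C where "C > 0"
    "\<And>n. real (M (Suc n)) powr (1 - s) * real (base_prod q (Suc n)) powr s \<le> C * real (base_prod M (Suc n))"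
proof -
  define e where "e = (1 - s) / 2"
  have e: "e > 0" using s by (simp add: e_def)
  let ?P = "\<lambda>n. real (base_prod q n)" and ?N = "\<lambda>n. real (base_prod M n)"
  have P: "?P n > 0" for n using base_prod_pos[OF q] by simp
  have N: "?N n > 0" for n using M by (rule real_base_prod_pos)
  have q0: "real (q (Suc n)) > 0" for n
  proof -
    have "2 \<le> q (Suc n)" using q by (simp add: basic_seq_def)
    then show ?thesis by simp
  qed
  have M0: "real (M n) > 0" for n using M[of n] by simp
  have ratio: "real (q (Suc n)) / real (M (Suc n)) \<le> 2 * real b * real (k (Suc n))" for n
  proof -
    have "real (q (Suc n)) \<le> real (2 * b * k (Suc n) * M (Suc n))" using qM[of n] by (simp only: of_nat_le_iff)
    then show ?thesis using M0[of "Suc n"] by (simp add: pos_divide_le_eq)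
  qed
  have factor: "real (q (Suc n)) powr s / real (M (Suc n)) \<le> 2 * real b * real (q (Suc n)) powr - e" for n
  proof -
    let ?q = "real (q (Suc n))"
    have "?q powr s / real (M (Suc n)) = ?q powr (s - 1) * (?q / real (M (Suc n)))"
      using q0[of n] by (simp add: powr_diff)
    also have "\<dots> \<le> ?q powr (s - 1) * (2 * real b * ?q powr e)"
    proof (intro mult_left_mono)
      have "2 * real b * real (k (Suc n)) \<le> 2 * real b * ?q powr e"
        using k(3)[of n] by (intro mult_left_mono) (auto simp: e_def)
      with ratio[of n] show "?q / real (M (Suc n)) \<le> 2 * real b * ?q powr e" by linarith
    qed simp
    also have "\<dots> = 2 * real b * ?q powr (s - 1 + e)" by (simp add: powr_add)
    also have "s - 1 + e = - e" by (simp add: e_def field_simps)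
    finally show ?thesis .
  qed
  \<comment> \<open>The factor \<open>n + 1\<close> pays for the loss of one level. \<open>W\<close>
    still decreases eventually, because a step factor of at most \<open>1/2\<close> outweighs
    \<open>(n + 2) / (n + 1)\<close>.\<close>
  define W where "W n = ?P n powr s / ?N n * (real n + 1)" for n
  have W_Suc: "W (Suc n) = ?P n powr s / ?N n * (real (q (Suc n)) powr s / real (M (Suc n)) * (real n + 2))" for n
    by (simp add: W_def base_prod_Suc powr_mult add.commute)
  have "(\<lambda>n. 2 * real b * real (q (Suc n)) powr - e) \<longlonglongrightarrow> 2 * real b * 0"
    using e by (intro tendsto_mult tendsto_const tendsto_neg_powr infinite_in_limit_filterlim_Suc[OF lim]) simp
  then have "\<forall>\<^sub>F n in sequentially. 2 * real b * real (q (Suc n)) powr - e < 1/2"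
    by (rule order_tendstoD) simp
  then have "\<forall>\<^sub>F n in sequentially. W (Suc n) \<le> W n"
  proof eventually_elim
    case (elim n)
    have "real (q (Suc n)) powr s / real (M (Suc n)) \<le> 1/2"
      using elim factor[of n] by linarith
    then have "real (q (Suc n)) powr s / real (M (Suc n)) * (real n + 2) \<le> 1/2 * (real n + 2)"
      by (rule mult_right_mono) simp
    also have "\<dots> \<le> real n + 1" by simp
    finally show ?case
      unfolding W_Suc unfolding W_def using N[of n] by (intro mult_left_mono) auto
  qed
  then obtain C0 where C0: "C0 > 0" "\<And>n. W n \<le> C0"
    using eventually_decreasing_bounded by blast
  show ?thesis
  proof (rule that[of "2 * real b * C0"])
    show "2 * real b * C0 > 0" using C0 b by simp
    fix n
    let ?q = "real (q (Suc n))" and ?M = "real (M (Suc n))"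
    \<comment> \<open>The last level carries the power \<open>(q / M) powr s\<close>. The base on
      the right is at least 1, so the exponent may be raised to 1, which leaves a bound linear in
      \<open>n\<close>.\<close>
    have "(?q / ?M) powr s \<le> (2 * real b * real (k (Suc n))) powr s"
      using s ratio[of n] by (intro powr_mono2) auto
    also have "\<dots> \<le> (2 * real b * real (k (Suc n))) powr 1"
    proof (intro powr_mono)
      have "1 \<le> 2 * b * k (Suc n)" using b k(1)[of n] by simp
      then have "real 1 \<le> real (2 * b * k (Suc n))" by (simp only: of_nat_le_iff)
      then show "1 \<le> 2 * real b * real (k (Suc n))" by simp
    qed (use s in simp)
    also have "\<dots> = 2 * real b * real (k (Suc n))" by simp
    also have "\<dots> \<le> 2 * real b * (real n + 1)"
      using k(2)[of n] by (intro mult_left_mono) auto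
    finally have level: "(?q / ?M) powr s \<le> 2 * real b * (real n + 1)" .
    have "?M powr (1 - s) * ?P (Suc n) powr s = ?M * (?P n powr s * (?q / ?M) powr s)"
      using M0[of "Suc n"] by (simp add: base_prod_Suc powr_mult powr_diff powr_divide)
    also have "\<dots> \<le> ?M * (?P n powr s * (2 * real b * (real n + 1)))"
      by (intro mult_left_mono level) auto
    also have "\<dots> = 2 * real b * W n * (?N n * ?M)"
      using N[of n] by (simp add: W_def)
    also have "\<dots> \<le> 2 * real b * C0 * (?N n * ?M)"
      using C0(2)[of n] by (intro mult_right_mono mult_left_mono) auto
    also have "\<dots> = 2 * real b * C0 * ?N (Suc n)" by (simp add: base_prod_Suc)
    finally show "?M powr (1 - s) * ?P (Suc n) powr s \<le> 2 * real b * C0 * ?N (Suc n)" .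
  qed
qed

text \<open>The block holds the \<open>M\<close> multiples of \<open>b\<close> just below the
  largest one not exceeding \<open>u * q\<close>, or those from 0 on if there is no room, by
  truncated subtraction. The bound \<open>max b q\<close> means that the block fits below
  \<open>q\<close> or, for \<open>q < b\<close>, consists of the digit 0 alone.\<close>

lemma digit_block:
  fixes q b M i :: nat and u :: real
  assumes "2 \<le> q" "2 \<le> b" "1 \<le> M" "b * M \<le> max b q" "0 \<le> u" "u < 1" "i < M"
  defines "A \<equiv> nat \<lfloor>u * real q / real b\<rfloor> - M"
  shows "b * (A + i) + 2 \<le> q"
    and "\<bar>real (b * (A + i)) - u * real q\<bar> \<le> 2 * real b * real M"
proof -
  define w where "w = nat \<lfloor>u * real q / real b\<rfloor>"
  have "real w \<le> u * real q / real b" "u * real q / real b < real w + 1"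
    using assms unfolding w_def by simp_all
  then have w: "real b * real w \<le> u * real q" "u * real q < real b * real w + real b"
    using assms by (simp_all add: field_simps)
  have uq: "u * real q \<le> real q" using assms by (simp add: mult_le_cancel_right1)
  have bwq: "b * w \<le> q"
  proof -
    have "real (b * w) \<le> real q" using w uq by simp
    then show ?thesis by (simp only: of_nat_le_iff)
  qed
  have bi: "b * i + b \<le> b * M" using \<open>i < M\<close> by (metis Suc_leI add.commute mult_Suc_right mult_le_mono2)
  have iM: "real b * real i \<le> real b * real M" "real b \<le> real b * real M"
    using assms by simp_all
  show "b * (A + i) + 2 \<le> q"
  proof (cases "w < M")
    case True
    then have A: "A = 0" by (simp add: A_def w_def)
    show ?thesis
    proof (cases "q < b")
      case True
      then have "b * M \<le> b * 1" using assms by simp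
      then have "M = 1" using assms by simp
      then show ?thesis using A assms by simp
    next
      case False
      then show ?thesis using A bi assms by simp
    qed
  next
    case False
    then have "A + i + 1 \<le> w" using \<open>i < M\<close> by (simp add: A_def w_def)
    then have "b * (A + i + 1) \<le> b * w" by (rule mult_le_mono2)
    then show ?thesis using bwq assms by simp
  qed
  show "\<bar>real (b * (A + i)) - u * real q\<bar> \<le> 2 * real b * real M"
  proof (cases "w < M")
    case True
    then have A: "A = 0" by (simp add: A_def w_def)
    have "real (w + 1) \<le> real M" using True by (simp only: of_nat_le_iff)
    then have "real b * real (w + 1) \<le> real b * real M" by (intro mult_left_mono) auto
    moreover have "0 \<le> u * real q" using assms by simp
    moreover have "0 \<le> real b * real i" by simp
    moreover have "real (b * (A + i)) = real b * real i" by (simp add: A)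
    moreover have "real b * real (w + 1) = real b * real w + real b" by (simp add: distrib_left)
    ultimately show ?thesis using w iM by linarith
  next
    case False
    then have RA: "real A = real w - real M" by (simp add: A_def w_def of_nat_diff)
    have "real (b * (A + i)) = real b * real w - real b * real M + real b * real i"
      by (simp add: RA distrib_left right_diff_distrib)
    moreover have "0 \<le> real b * real i" by simp
    ultimately show ?thesis using w iM by linarith
  qed
qed

lemma hausdorff_outer_measure_exceptional:
  fixes r s :: real
  assumes q: "basic_seq q" and lim: "infinite_in_limit q" and r: "r \<in> \<rat>" "r \<notin> \<int>"
    and s: "0 < s" "s < 1"
  shows "hausdorff_outer_measure s {x \<in> DN q. r * x \<notin> DN q} \<noteq> 0"
proof -
  obtain b where b: "b \<ge> 2" "r * real b \<in> \<int>"
  proof -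
    obtain m n :: int where mn: "n > 0" "r = of_int m / of_int n"
      using r(1) by (elim Rats_cases') auto
    have "n \<noteq> 1" using mn r(2) by auto
    then have "nat n \<ge> 2" using mn by linarith
    moreover have "r * real (nat n) = of_int m" using mn by simp
    ultimately show ?thesis using that[of "nat n"] by simp
  qed
  obtain x0 where x0: "x0 \<in> DN q" using DN_nonempty[OF q] by blast
  have q2: "2 \<le> q (Suc n)" for n using q by (simp add: basic_seq_def)
  define e where "e = (1 - s) / 2"
  have e: "e > 0" using s by (simp add: e_def)
  \<comment> \<open>Slow enough for the growth estimate, yet unbounded, so that blocks covering
    about \<open>1 / k n\<close> of the digit range shrink relative to \<open>q n\<close>.\<close>
  define k where "k n = max 1 (min n (nat \<lfloor>real (q n) powr e\<rfloor>))" for n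
  define M where "M n = max 1 (q n div (b * k n))" for n
  \<comment> \<open>The \<open>n\<close>-th digit steers the orbit at time \<open>n - 1\<close>,
    hence the shift of the index.\<close>
  define A where "A n = nat \<lfloor>frac (real (base_prod q (n - 1)) * x0) * real (q n) / real b\<rfloor> - M n" for n
  have M1: "M n \<ge> 1" for n by (simp add: M_def)
  have k1: "1 \<le> k n" for n by (simp add: k_def)
  have kn: "k (Suc n) \<le> Suc n" for n by (simp add: k_def)
  have ke: "real (k (Suc n)) \<le> real (q (Suc n)) powr e" for n
  proof -
    have one: "1 \<le> real (q (Suc n)) powr e" using q2[of n] e by (intro ge_one_powr_ge_zero) auto
    have "k (Suc n) \<le> max 1 (nat \<lfloor>real (q (Suc n)) powr e\<rfloor>)" by (simp add: k_def)
    then have "real (k (Suc n)) \<le> real (max 1 (nat \<lfloor>real (q (Suc n)) powr e\<rfloor>))"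
      by (simp only: of_nat_le_iff)
    also have "\<dots> \<le> real (q (Suc n)) powr e" using one by (simp add: max_def)
    finally show ?thesis .
  qed
  have qM: "q (Suc n) \<le> 2 * b * k (Suc n) * M (Suc n)" for n
  proof -
    let ?c = "b * k (Suc n)"
    have c: "?c > 0" using b k1[of "Suc n"] by simp
    have "q (Suc n) < ?c + ?c * (q (Suc n) div ?c)" by (rule dividend_less_times_div[OF c])
    also have "\<dots> \<le> ?c * M (Suc n) + ?c * M (Suc n)"
      using M1[of "Suc n"] by (intro add_mono mult_le_mono2) (simp_all add: M_def)
    finally show ?thesis by simp
  qed
  have bM: "b * M n \<le> max b (q n)" for n
  proof -
    have "b * (q n div (b * k n)) \<le> q n"
      using div_mult2_eq[of "q n" "k n" b] by (metis div_le_dividend le_trans mult.commute times_div_less_eq_dividend)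
    then show ?thesis
      by (cases "q n div (b * k n) = 0") (simp_all add: M_def max_absorb2 le_max_iff_disj)
  qed
  obtain C where C: "C > 0"
    "\<And>n. real (M (Suc n)) powr (1 - s) * real (base_prod q (Suc n)) powr s \<le> C * real (base_prod M (Suc n))"
    using cantor_growth[where q=q and M=M and k=k and b=b and s=s, OF q lim s b(1) M1 k1 kn ke[unfolded e_def] qM]
    by blast
  \<comment> \<open>The growth estimate itself forces this: \<open>C * base_prod M n\<close>
    dominates \<open>base_prod q n powr s\<close>, hence \<open>2 powr (s * n)\<close>, for positive
    \<open>n\<close>.\<close>
  have N_lim: "filterlim (\<lambda>n. real (base_prod M n)) at_top sequentially"
  proof -
    have ge: "(2 powr s) ^ Suc n / C \<le> real (base_prod M (Suc n))" for n
    proof -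
      have "real (2 ^ Suc n) \<le> real (base_prod q (Suc n))"
        using two_power_le_base_prod[OF q] by (simp only: of_nat_le_iff)
      then have "(2 ^ Suc n) powr s \<le> real (base_prod q (Suc n)) powr s"
        using s by (intro powr_mono2) auto
      also have "\<dots> \<le> real (M (Suc n)) powr (1 - s) * real (base_prod q (Suc n)) powr s"
        using M1[of "Suc n"] s by (simp add: mult_le_cancel_right1 ge_one_powr_ge_zero)
      also have "\<dots> \<le> C * real (base_prod M (Suc n))" by (rule C)
      finally have "(2 ^ Suc n) powr s \<le> C * real (base_prod M (Suc n))" .
      moreover have "(2 ^ Suc n) powr s = (2 powr s) ^ Suc n"
        by (simp add: powr_powr mult.commute powr_realpow[symmetric] del: power_Suc)
      ultimately show ?thesis using C(1) by (simp add: pos_divide_le_eq mult.commute)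
    qed
    have gt: "1 < 2 powr s" using s by (intro gr_one_powr) auto
    have "filterlim (\<lambda>n. norm ((2 powr s) ^ n)) at_top sequentially"
      using gt by (intro filterlim_at_infinity_imp_norm_at_top filterlim_realpow_sequentially_gt1) simp
    then have "filterlim (\<lambda>n. (2 powr s) ^ Suc n) at_top sequentially"
      by (simp add: norm_power filterlim_sequentially_Suc del: power_Suc)
    then have "filterlim (\<lambda>n. (1 / C) * (2 powr s) ^ Suc n) at_top sequentially"
      by (rule filterlim_tendsto_pos_mult_at_top[OF tendsto_const, rotated]) (use C(1) in simp)
    then have "filterlim (\<lambda>n. real (base_prod M (Suc n))) at_top sequentially"
      by (rule filterlim_at_top_mono) (use ge in auto)
    then show ?thesis by (rule filterlim_sequentially_Suc[where f = "\<lambda>n. real (base_prod M n)", THEN iffD1])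
  qed
  let ?E = "cantor_digit b A M"
  have u: "0 \<le> frac (real (base_prod q n) * x0)" "frac (real (base_prod q n) * x0) < 1" for n
    by (simp_all add: frac_lt_1)
  have imod: "index M y n mod M n < M n" for y n using M1[of n] by simp
  have E2: "?E y (Suc n) + 2 \<le> q (Suc n)" for y n
    unfolding cantor_digit_def A_def
    by (simp only: diff_Suc_1) (rule digit_block(1)[OF q2 b(1) M1 bM u imod])
  have E1: "?E y (Suc n) < q (Suc n)" for y n using E2[of y n] by linarith
  have Ed: "b dvd ?E y (Suc n)" for y n by (simp add: cantor_digit_def)
  have q_lim: "filterlim (\<lambda>n. real (q (Suc n))) at_top sequentially"
    by (rule infinite_in_limit_filterlim_Suc[OF lim])
  have k_lim: "filterlim (\<lambda>n. real (k (Suc n))) at_top sequentially"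
    unfolding filterlim_at_top
  proof
    fix Z :: real
    \<comment> \<open>At least 1 so that the powers cancel; the extra 1 in \<open>Z + 1\<close>
      compensates for the floor in \<open>k\<close>.\<close>
    define z where "z = max 1 (Z + 1)"
    have "\<forall>\<^sub>F n in sequentially. z powr (1 / e) \<le> real (q (Suc n))"
      using q_lim by (simp add: filterlim_at_top)
    then have "\<forall>\<^sub>F n in sequentially. Z + 1 \<le> real (q (Suc n)) powr e"
    proof eventually_elim
      case (elim n)
      have "(z powr (1 / e)) powr e \<le> real (q (Suc n)) powr e"
        using elim e by (intro powr_mono2) auto
      then show ?case using e by (simp add: powr_powr z_def)
    qed
    moreover have "\<forall>\<^sub>F n in sequentially. Z \<le> real n"
      using filterlim_real_sequentially by (simp add: filterlim_at_top)
    ultimately show "\<forall>\<^sub>F n in sequentially. Z \<le> real (k (Suc n))"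
    proof eventually_elim
      case (elim n)
      have "Z \<le> real (nat \<lfloor>real (q (Suc n)) powr e\<rfloor>)" using elim by linarith
      then have "Z \<le> real (min (Suc n) (nat \<lfloor>real (q (Suc n)) powr e\<rfloor>))"
        using elim by (simp add: min_def)
      also have "\<dots> \<le> real (k (Suc n))"
        unfolding k_def by (simp only: of_nat_le_iff max.cobounded2)
      finally show ?case .
    qed
  qed
  \<comment> \<open>The relative block length is at most \<open>b / q\<close> plus
    \<open>1 / k\<close>: the first term covers the case where \<open>M\<close> is raised to 1, the
    second the quotient \<open>q div (b * k)\<close>.\<close>
  have bMq: "(\<lambda>n. 2 * (real b * real (M (Suc n)) / real (q (Suc n)))) \<longlonglongrightarrow> 0"
  proof (rule Lim_null_comparison)
    have "(\<lambda>n. 2 * (real b / real (q (Suc n)) + 1 / real (k (Suc n)))) \<longlonglongrightarrow> 2 * (0 + 0)"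
      using q_lim k_lim
      by (intro tendsto_intros tendsto_divide_0[OF tendsto_const] filterlim_at_top_imp_at_infinity)
    then show "(\<lambda>n. 2 * (real b / real (q (Suc n)) + 1 / real (k (Suc n)))) \<longlonglongrightarrow> 0" by simp
    have "real b * real (M (Suc n)) / real (q (Suc n)) \<le> real b / real (q (Suc n)) + 1 / real (k (Suc n))" for n
    proof -
      have q0: "real (q (Suc n)) > 0" using q2[of n] by simp
      have k0: "real (k (Suc n)) > 0" using k1[of "Suc n"] by simp
      have "b * (q (Suc n) div (b * k (Suc n))) * k (Suc n) \<le> q (Suc n)"
        by (metis mult.assoc mult.commute times_div_less_eq_dividend)
      then have "real (b * (q (Suc n) div (b * k (Suc n)))) * real (k (Suc n)) \<le> real (q (Suc n))"
        by (simp only: of_nat_le_iff flip: of_nat_mult)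
      then have "real (b * (q (Suc n) div (b * k (Suc n)))) \<le> real (q (Suc n)) / real (k (Suc n))"
        using k0 by (simp add: pos_le_divide_eq)
      moreover have "real b * real (M (Suc n)) \<le> real b + real (b * (q (Suc n) div (b * k (Suc n))))"
        by (simp add: M_def max_def)
      ultimately have "real b * real (M (Suc n)) \<le> real b + real (q (Suc n)) / real (k (Suc n))" by linarith
      then have "real b * real (M (Suc n)) / real (q (Suc n)) \<le> (real b + real (q (Suc n)) / real (k (Suc n))) / real (q (Suc n))"
        using q0 by (intro divide_right_mono) auto
      also have "\<dots> = real b / real (q (Suc n)) + 1 / real (k (Suc n))"
        using q0 by (simp add: add_divide_distrib)
      finally show ?thesis .
    qed
    then have "2 * (real b * real (M (Suc n)) / real (q (Suc n)))
        \<le> 2 * (real b / real (q (Suc n)) + 1 / real (k (Suc n)))" for n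
      by (rule mult_left_mono) simp
    moreover have "norm (2 * (real b * real (M (Suc n)) / real (q (Suc n))))
        = 2 * (real b * real (M (Suc n)) / real (q (Suc n)))" for n by simp
    ultimately show "\<forall>\<^sub>F n in sequentially. norm (2 * (real b * real (M (Suc n)) / real (q (Suc n))))
        \<le> 2 * (real b / real (q (Suc n)) + 1 / real (k (Suc n)))"
      by (intro always_eventually allI) (simp only:)
  qed
  have close: "(\<lambda>n. real (?E y (Suc n)) / real (q (Suc n)) - frac (real (base_prod q n) * x0)) \<longlonglongrightarrow> 0" for y
  proof (rule Lim_null_comparison[OF _ bMq], intro always_eventually allI)
    fix n
    have q0: "real (q (Suc n)) > 0" using q2[of n] by simp
    have "\<bar>real (?E y (Suc n)) - frac (real (base_prod q n) * x0) * real (q (Suc n))\<bar> \<le> 2 * real b * real (M (Suc n))"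
      unfolding cantor_digit_def A_def
      by (simp only: diff_Suc_1) (rule digit_block(2)[OF q2 b(1) M1 bM u imod])
    then have "\<bar>real (?E y (Suc n)) - frac (real (base_prod q n) * x0) * real (q (Suc n))\<bar> / real (q (Suc n))
        \<le> 2 * real b * real (M (Suc n)) / real (q (Suc n))"
      using q0 by (intro divide_right_mono) auto
    moreover have "real (?E y (Suc n)) / real (q (Suc n)) - frac (real (base_prod q n) * x0)
        = (real (?E y (Suc n)) - frac (real (base_prod q n) * x0) * real (q (Suc n))) / real (q (Suc n))"
      using q0 by (simp add: diff_divide_distrib)
    ultimately show "norm (real (?E y (Suc n)) / real (q (Suc n)) - frac (real (base_prod q n) * x0))
        \<le> 2 * (real b * real (M (Suc n)) / real (q (Suc n)))"
      by simp
  qed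
  show ?thesis
  proof (rule hausdorff_outer_measure_neq_0[of "2 * C" "\<lambda>y. expansion q (?E y)"])
    show "2 * C > 0" using C by simp
    show "s > 0" by (rule s)
    show "expansion q (?E y) \<in> {x \<in> DN q. r * x \<notin> DN q}" for y
    proof -
      have "expansion q (?E y) \<in> DN q"
        by (rule expansion_mem_DN[OF q lim x0 E2 close])
      moreover from this have "r * expansion q (?E y) \<notin> DN q"
        by (rule scaled_expansion_not_mem_DN[OF q r(2) b(2) E2 Ed])
      ultimately show ?thesis by simp
    qed
    show "\<bar>y - y'\<bar> \<le> 2 * C * \<bar>expansion q (?E y) - expansion q (?E y')\<bar> powr s"
      if "0 \<le> y" "y < 1" "0 \<le> y'" "y' < 1" for y y'
      by (rule cantor_holder[where M=M, OF q b(1) M1 N_lim E1 that s C])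
  qed
qed

theorem theorem3p4:
  shows "(\<forall>q (r::int) x. basic_seq q \<and> r \<noteq> 0 \<and> x \<in> DN q \<longrightarrow> real_of_int r * x \<in> DN q) \<and>
         (\<forall>q (r::real). basic_seq q \<and> infinite_in_limit q \<and> r \<in> \<rat> \<and> r \<notin> \<int> \<longrightarrow>
            {x \<in> DN q. r * x \<notin> DN q} \<in> null_sets lebesgue \<and>
            hausdorff_dim {x \<in> DN q. r * x \<notin> DN q} = 1)"
proof (intro conjI allI impI)
  show "real_of_int r * x \<in> DN q" if "basic_seq q \<and> r \<noteq> 0 \<and> x \<in> DN q" for q r x
    using that DN_of_int_mult by blast
next
  fix q :: "nat \<Rightarrow> nat" and r :: real
  assume A: "basic_seq q \<and> infinite_in_limit q \<and> r \<in> \<rat> \<and> r \<notin> \<int>"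
  then have "r \<noteq> 0" by auto
  then have "negligible {x. r * x \<notin> DN q}" using A by (intro negligible_scale_not_DN) auto
  then have "negligible {x \<in> DN q. r * x \<notin> DN q}" by (rule negligible_subset) auto
  then show "{x \<in> DN q. r * x \<notin> DN q} \<in> null_sets lebesgue"
    by (simp add: negligible_iff_null_sets)
  show "hausdorff_dim {x \<in> DN q. r * x \<notin> DN q} = 1"
    using A by (intro hausdorff_dim_eq_1 hausdorff_outer_measure_exceptional) auto
qed

end
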